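(* Let $T>0$, $R_0:=2\cdot 6^{1/5}\cdot e^{(5e)^{-1}}>1$ and $R>2R_0$. Given $u_1\in\mathcal{R}_R$, there exist control inputs $h_1,h_2\in G^5([0,T])$ for which the solution $u$ of $$\begin{cases} u_t+u_x+u_{xxx}-u_{xxxxx}=0, & (x,t)\in(-1,0)\times(0,T),\\ u(0,t)=u_x(0,t)=u_{xx}(0,t)=0, & t\in(0,T),\\ u(-1,t)=h_1(t),\quad u_x(-1,t)=h_2(t), & t\in(0,T),\\ u(x,0)=0, & x\in(-1,0)\end{cases}$$ satisfies $u(\cdot,T)=u_1$ and $u\in G^{1,5}([-1,0]\times[0,T])$.
   Context: Let $Pu=\partial_xu+\partial_x^3u-\partial_x^5u$, $P^0=\mathrm{Id}$ and $P^n=P\circ P^{n-1}$ for $n\ge1$. For $R>0$ let $D(0,R)=\{z\in\mathbb{C}: |z|<R\}$ and let $H(D(0,R))$ be the set of holomorphic functions on $D(0,R)$. For $R>1$, the set of reachable states is $$\mathcal{R}_R:=\{u\in C([-1,0]) : \exists z\in H(D(0,R)) \text{ with } u=z|_{[-1,0]}, \text{ and } (\partial_x^jP^nu)(0)=0 \text{ for } j=0,1,2 \text{ and all } n\ge 0\}.$$ Gevrey spaces: for $s_1,s_2\ge 0$, $G^{s_1,s_2}([a,b]\times[t_1,t_2])$ is the vector space of functions $u:[a,b]\times[t_1,t_2]\to\mathbb{R}$ with $u\in C^\infty([a,b]\times[t_1,t_2])$ for which there exist positive constants $C,R_1,R_2$ such that $|\partial_x^n\partial_t^m u(x,t)|\le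 C\frac{n!^{s_1}}{R_1^n}\frac{m!^{s_2}}{R_2^m}$ for all $n,m\ge 0$ and all $(x,t)\in[a,b]\times[t_1,t_2]$. Here $n!^{s}$ means $(n!)^s$. Similarly, $G^s([a,b])$ is the space of $h\in C^\infty([a,b])$ for which there exist $C,R>0$ with $|h^{(n)}(t)|\le C\frac{n!^s}{R^n}$ for all $n\ge0$ and $t\in[a,b]$. States are real-valued functions. *)

theory Defs
  imports "HOL-Complex_Analysis.Complex_Analysis"
begin

text \<open>
  Functions on an interval (or rectangle) are represented by total functions of which only the
  values on the interval (rectangle) matter.  All derivatives are taken within the
  interval, so at an endpoint they are one-sided.
\<close>

definition D_on :: "real \<Rightarrow> real \<Rightarrow> (real \<Rightarrow> real) \<Rightarrow> real \<Rightarrow> real" where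
  "D_on a b f = (\<lambda>x. vector_derivative f (at x within {a..b}))"

definition smooth_on_interval :: "real \<Rightarrow> real \<Rightarrow> (real \<Rightarrow> real) \<Rightarrow> bool" where
  "smooth_on_interval a b f \<longleftrightarrow>
     (\<forall>n. \<forall>x\<in>{a..b}. (D_on a b ^^ n) f differentiable (at x within {a..b}))"

definition gevrey :: "real \<Rightarrow> real \<Rightarrow> real \<Rightarrow> (real \<Rightarrow> real) set" where
  "gevrey s a b = {h. smooth_on_interval a b h \<and>
     (\<exists>C>0. \<exists>R>0. \<forall>n. \<forall>t\<in>{a..b}.
        \<bar>(D_on a b ^^ n) h t\<bar> \<le> C * (fact n powr s / R ^ n))}"

definition Dx_on :: "real \<Rightarrow> real \<Rightarrow> (real \<Rightarrow> real \<Rightarrow> real) \<Rightarrow> real \<Rightarrow> real \<Rightarrow> real" where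
  "Dx_on a b u = (\<lambda>x t. D_on a b (\<lambda>y. u y t) x)"

definition Dt_on :: "real \<Rightarrow> real \<Rightarrow> (real \<Rightarrow> real \<Rightarrow> real) \<Rightarrow> real \<Rightarrow> real \<Rightarrow> real" where
  "Dt_on c d u = (\<lambda>x t. D_on c d (u x) t)"

primrec Ck_on_rectangle ::
  "nat \<Rightarrow> real \<Rightarrow> real \<Rightarrow> real \<Rightarrow> real \<Rightarrow> (real \<Rightarrow> real \<Rightarrow> real) \<Rightarrow> bool" where
  "Ck_on_rectangle 0 a b c d u \<longleftrightarrow> continuous_on ({a..b} \<times> {c..d}) (\<lambda>(x, t). u x t)"
| "Ck_on_rectangle (Suc k) a b c d u \<longleftrightarrow>
     continuous_on ({a..b} \<times> {c..d}) (\<lambda>(x, t). u x t) \<and>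
     (\<forall>x\<in>{a..b}. \<forall>t\<in>{c..d}.
        (\<lambda>y. u y t) differentiable (at x within {a..b}) \<and>
        u x differentiable (at t within {c..d})) \<and>
     Ck_on_rectangle k a b c d (Dx_on a b u) \<and>
     Ck_on_rectangle k a b c d (Dt_on c d u)"

definition smooth_on_rectangle ::
  "real \<Rightarrow> real \<Rightarrow> real \<Rightarrow> real \<Rightarrow> (real \<Rightarrow> real \<Rightarrow> real) \<Rightarrow> bool" where
  "smooth_on_rectangle a b c d u \<longleftrightarrow> (\<forall>k. Ck_on_rectangle k a b c d u)"

definition gevrey2 ::
  "real \<Rightarrow> real \<Rightarrow> real \<Rightarrow> real \<Rightarrow> real \<Rightarrow> real \<Rightarrow> (real \<Rightarrow> real \<Rightarrow> real) set" where
  "gevrey2 s1 s2 a b c d = {u. smooth_on_rectangle a b c d u \<and>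
     (\<exists>C>0. \<exists>R1>0. \<exists>R2>0. \<forall>n m. \<forall>x\<in>{a..b}. \<forall>t\<in>{c..d}.
        \<bar>(Dx_on a b ^^ n) ((Dt_on c d ^^ m) u) x t\<bar>
          \<le> C * (fact n powr s1 / R1 ^ n) * (fact m powr s2 / R2 ^ m))}"

definition P_op :: "(real \<Rightarrow> real) \<Rightarrow> real \<Rightarrow> real" where
  "P_op u = (\<lambda>x. D_on (-1) 0 u x + (D_on (-1) 0 ^^ 3) u x - (D_on (-1) 0 ^^ 5) u x)"

definition reachable_states :: "real \<Rightarrow> (real \<Rightarrow> real) set" where
  "reachable_states R = {u. continuous_on {-1..0} u \<and>
     (\<exists>z. z holomorphic_on ball 0 R \<and> (\<forall>x\<in>{-1..0}. z (complex_of_real x) = complex_of_real (u x))) \<and>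
     (\<forall>n. \<forall>j\<in>{0, 1, 2}. (D_on (-1) 0 ^^ j) ((P_op ^^ n) u) 0 = 0)}"

text \<open>
  Classical solutions: continuous on the closed rectangle, with the derivatives occurring in the
  equation existing and continuous up to the lateral boundary for positive times before \<open>T\<close>.
  This regularity gives meaning to the boundary values of the derivatives and makes the solution
  unique; the equation and the side conditions are imposed only on the open sets.
\<close>

definition kawahara_solution ::
  "real \<Rightarrow> (real \<Rightarrow> real) \<Rightarrow> (real \<Rightarrow> real) \<Rightarrow> (real \<Rightarrow> real \<Rightarrow> real) \<Rightarrow> bool" where
  "kawahara_solution T h1 h2 u \<longleftrightarrow>
     continuous_on ({-1..0} \<times> {0..T}) (\<lambda>(x, t). u x t) \<and>
     (\<forall>j<5. \<forall>x\<in>{-1..0}. \<forall>t\<in>{0<..<T}.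
        (\<lambda>y. (Dx_on (-1) 0 ^^ j) u y t) differentiable (at x within {-1..0})) \<and>
     (\<forall>j\<le>5. continuous_on ({-1..0} \<times> {0<..<T}) (\<lambda>(x, t). (Dx_on (-1) 0 ^^ j) u x t)) \<and>
     (\<forall>x\<in>{-1..0}. \<forall>t\<in>{0<..<T}. u x differentiable (at t within {0..T})) \<and>
     continuous_on ({-1..0} \<times> {0<..<T}) (\<lambda>(x, t). Dt_on 0 T u x t) \<and>
     (\<forall>x\<in>{-1<..<0}. \<forall>t\<in>{0<..<T}.
        Dt_on 0 T u x t + Dx_on (-1) 0 u x t
          + (Dx_on (-1) 0 ^^ 3) u x t - (Dx_on (-1) 0 ^^ 5) u x t = 0) \<and>
     (\<forall>t\<in>{0<..<T}. u 0 t = 0 \<and> Dx_on (-1) 0 u 0 t = 0 \<and> (Dx_on (-1) 0 ^^ 2) u 0 t = 0) \<and>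
     (\<forall>t\<in>{0<..<T}. u (-1) t = h1 t \<and> Dx_on (-1) 0 u (-1) t = h2 t) \<and>
     (\<forall>x\<in>{-1<..<0}. u x 0 = 0)"

definition R0 :: real where
  "R0 = 2 * 6 powr (1/5) * exp (inverse (5 * exp 1))"

lemma R0_gt_1: "R0 > 1"
proof -
  have "(1::real) \<le> 6 powr (1/5)" by (rule ge_one_powr_ge_zero) auto
  moreover have "(1::real) \<le> exp (inverse (5 * exp 1))" by simp
  ultimately have "1 * 1 \<le> (6::real) powr (1/5) * exp (inverse (5 * exp 1))"
    by (intro mult_mono) auto
  then show ?thesis unfolding R0_def by (simp add: mult.assoc)
qed

end

theory Submission
  imports Defs
begin

text \<open>
  The solution is sought as \<open>u(x, t) = \<Sum>\<^sub>k a\<^sub>k(t) x\<^sup>k / k!\<close> with \<open>a\<^sub>0 = a\<^sub>1 = a\<^sub>2 = 0\<close>, \<open>a\<^sub>3 = y\<close>, \<open>a\<^sub>4 = z\<close>; the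
  equation amounts to \<open>a\<^bsub>k+5\<^esub> = a\<^sub>k' + a\<^bsub>k+1\<^esub> + a\<^bsub>k+3\<^esub>\<close>. If the \<open>m\<close>-th derivatives of the flat outputs \<open>y\<close> and
  \<open>z\<close> are bounded by a constant times \<open>(5m)! / (5/4)\<^bsup>5m\<^esup>\<close>, the series converges on a neighbourhood of
  \<open>[-1, 0]\<close> and is Gevrey of order 1 in \<open>x\<close> and 5 in \<open>t\<close>. The state is reached at time \<open>T\<close> as soon as
  \<open>y\<^bsup>(m)\<^esup>(T)\<close> and \<open>z\<^bsup>(m)\<^esup>(T)\<close> are the values at 0 of the third and fourth derivatives of \<open>(-P)\<^sup>m u\<^sub>1\<close>, which
  by Cauchy's inequality on the disc of radius 5 are bounded by a constant times \<open>(5m)! / 3\<^bsup>5m\<^esup>\<close>.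

  Functions with prescribed jets \<open>d\<^sub>n\<close> at \<open>T\<close> come from a Borel--Laplace transform: the function
  \<open>D(w) = \<Sum>\<^sub>n d\<^sub>n w\<^bsup>5n\<^esup> / (5n)!\<close> depends on \<open>w\<^sup>5\<close> only, so its Taylor coefficients are recovered by integration
  over a fifth of the circle \<open>|w| = 14/5\<close>. That arc lies in a right half plane, where
  \<open>(5n)! / w\<^bsup>5n\<^esup> = w \<integral> s\<^bsup>5n\<^esup> exp (-w s) ds\<close>, whence
  \<open>f(T - \<tau>) = (5 / 2\<pi>) \<integral>\<integral> Re (D(w) w exp (-w s)) exp (-s\<^sup>5 \<tau>) ds d\<theta>\<close> with \<open>w = (14/5) exp (i\<theta>)\<close>.
  A cutoff of Gevrey order \<open>2 < 5\<close> makes \<open>f\<close> flat at 0 without worsening the geometric constant.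
\<close>

section \<open>Towers of derivatives\<close>

text \<open>All derivatives are carried along as one explicit family instead of as iterates of
  \<open>D_on\<close>, and are taken within the set, so that endpoints of closed intervals are
  covered.\<close>

definition jets :: "(nat \<Rightarrow> real \<Rightarrow> real) \<Rightarrow> real set \<Rightarrow> bool" where
  "jets f S \<longleftrightarrow> (\<forall>n. \<forall>x\<in>S. (f n has_real_derivative f (Suc n) x) (at x within S))"

lemma jetsI:
  assumes "\<And>n x. x \<in> S \<Longrightarrow> (f n has_real_derivative f (Suc n) x) (at x within S)"
  shows "jets f S"
  using assms by (simp add: jets_def)

lemma jetsD: "jets f S \<Longrightarrow> x \<in> S \<Longrightarrow> (f n has_real_derivative f (Suc n) x) (at x within S)"
  by (simp add: jets_def)

lemma jets_subset: "jets f S \<Longrightarrow> A \<subseteq> S \<Longrightarrow> jets f A"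
  by (meson jets_def has_field_derivative_subset subsetD)

lemma jets_continuous_on: "jets f S \<Longrightarrow> continuous_on S (f n)"
  by (meson DERIV_continuous_on jets_def)

text \<open>Agreement of \<open>f\<close> and \<open>g\<close> is asked for on the interval only,
  because iterates of \<open>D_on\<close> are controlled only there; \<open>a < b\<close> makes
  one-sided derivatives unique.\<close>

lemma D_on_eqI:
  assumes "a < b" "x \<in> {a..b}" "(g has_real_derivative D) (at x within {a..b})"
    "\<And>y. y \<in> {a..b} \<Longrightarrow> f y = g y"
  shows "D_on a b f x = D" and "f differentiable (at x within {a..b})"
proof -
  have "(f has_real_derivative D) (at x within {a..b})"
    using assms by (intro has_field_derivative_transform_within[OF assms(3), of 1 f]) auto
  moreover from this have "(f has_vector_derivative D) (at x within {a..b})"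
    by (simp add: has_real_derivative_iff_has_vector_derivative)
  ultimately show "D_on a b f x = D" "f differentiable (at x within {a..b})"
    using assms(1,2) vector_derivative_within_cbox[of a b x f D]
    by (auto simp: D_on_def real_differentiable_def)
qed

lemma D_on_funpow_jets:
  assumes "a < b" "jets q {a..b}" "\<And>y. y \<in> {a..b} \<Longrightarrow> f y = q 0 y" "x \<in> {a..b}"
  shows "(D_on a b ^^ n) f x = q n x"
  using assms(4)
proof (induction n arbitrary: x)
  case 0
  then show ?case using assms by simp
next
  case (Suc n)
  show ?case
    using D_on_eqI(1)[OF assms(1) Suc.prems jetsD[OF assms(2) Suc.prems, of n] Suc.IH] by simp
qed

lemma jets_differentiable:
  assumes "a < b" "jets q {a..b}" "\<And>y. y \<in> {a..b} \<Longrightarrow> f y = q 0 y" "x \<in> {a..b}"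
  shows "(D_on a b ^^ n) f differentiable (at x within {a..b})"
  using D_on_eqI(2)[OF assms(1,4) jetsD[OF assms(2,4), of n]] D_on_funpow_jets[OF assms(1-3)]
  by blast

lemma gevrey_jetsI:
  assumes "a < b" "jets q {a..b}" "C > 0" "B > 0"
    and bd: "\<And>n t. t \<in> {a..b} \<Longrightarrow> \<bar>q n t\<bar> \<le> C * (fact n powr s / B ^ n)"
  shows "q 0 \<in> gevrey s a b"
  unfolding gevrey_def smooth_on_interval_def mem_Collect_eq
proof (intro conjI)
  show "\<forall>n. \<forall>x\<in>{a..b}. (D_on a b ^^ n) (q 0) differentiable at x within {a..b}"
    using jets_differentiable[OF assms(1,2)] by simp
  show "\<exists>C>0. \<exists>R>0. \<forall>n. \<forall>t\<in>{a..b}. \<bar>(D_on a b ^^ n) (q 0) t\<bar> \<le> C * (fact n powr s / R ^ n)"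
    by (rule exI[of _ C], simp add: assms(3), rule exI[of _ B])
       (use assms(4) bd D_on_funpow_jets[OF assms(1,2), of "q 0"] in simp)
qed

text \<open>Leibniz' formula: differentiating each summand gives two sums, which Pascal's rule
  merges.\<close>

lemma jets_mult:
  assumes "jets f S" "jets g S"
  shows "jets (\<lambda>n x. \<Sum>k\<le>n. real (n choose k) * f k x * g (n - k) x) S"
proof (rule jetsI)
  fix n x assume x: "x \<in> S"
  define p where "p k = f k x * g (Suc n - k) x" for k
  have "((\<lambda>x. \<Sum>k\<le>n. real (n choose k) * f k x * g (n - k) x) has_real_derivative
     (\<Sum>k\<le>n. real (n choose k) * (f (Suc k) x * g (n - k) x + f k x * g (Suc (n - k)) x))) (at x within S)"
    by (auto intro!: derivative_eq_intros sum.cong jetsD[OF assms(1) x] jetsD[OF assms(2) x]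
        simp: algebra_simps)
  also have "(\<Sum>k\<le>n. real (n choose k) * (f (Suc k) x * g (n - k) x + f k x * g (Suc (n - k)) x))
     = (\<Sum>k\<le>n. real (n choose k) * p (Suc k)) + (\<Sum>k\<le>n. real (n choose k) * p k)"
    by (simp add: p_def distrib_left sum.distrib Suc_diff_le)
  \<comment> \<open>The added term is zero because \<open>n choose Suc n = 0\<close>.\<close>
  also have "(\<Sum>k\<le>n. real (n choose k) * p k) = (\<Sum>k\<le>Suc n. real (n choose k) * p k)"
    by simp
  also have "\<dots> = p 0 + (\<Sum>k\<le>n. real (n choose Suc k) * p (Suc k))"
    by (subst sum.atMost_Suc_shift) simp
  also have "(\<Sum>k\<le>n. real (n choose k) * p (Suc k)) + \<dots>
     = p 0 + (\<Sum>k\<le>n. real (Suc n choose Suc k) * p (Suc k))"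
    by (simp add: sum.distrib algebra_simps)
  also have "\<dots> = (\<Sum>k\<le>Suc n. real (Suc n choose k) * p k)"
    by (simp only: sum.atMost_Suc_shift binomial_n_0 of_nat_1 mult_1)
  finally show "((\<lambda>x. \<Sum>k\<le>n. real (n choose k) * f k x * g (n - k) x) has_real_derivative
     (\<Sum>k\<le>Suc n. real (Suc n choose k) * f k x * g (Suc n - k) x)) (at x within S)"
    by (simp add: p_def mult.assoc)
qed

section \<open>Uniqueness\<close>

lemma Dx_on_funpow_has_derivative:
  assumes "(\<lambda>y. (Dx_on a b ^^ j) u y t) differentiable (at x within {a..b})"
  shows "((\<lambda>y. (Dx_on a b ^^ j) u y t) has_real_derivative (Dx_on a b ^^ Suc j) u x t) (at x within {a..b})"
  using assms
  by (simp add: Dx_on_def D_on_def vector_derivative_works has_real_derivative_iff_has_vector_derivative)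

lemma Dt_on_has_derivative:
  assumes "u x differentiable (at t within {c..d})"
  shows "(u x has_real_derivative Dt_on c d u x t) (at t within {c..d})"
  using assms
  by (simp add: Dt_on_def D_on_def vector_derivative_works has_real_derivative_iff_has_vector_derivative)

text \<open>The energy of the difference \<open>w\<close> of two solutions, \<open>\<integral> w\<^sup>2\<close>, has derivative
  \<open>- w\<^sub>x\<^sub>x(-1, t)\<^sup>2\<close>: the integrand of the derivative is the \<open>x\<close>-derivative of \<open>G\<close> below.\<close>

lemma kawahara_solution_unique:
  assumes T: "T > 0" and u: "kawahara_solution T h1 h2 u" and v: "kawahara_solution T h1 h2 v"
    and "x \<in> {-1..0}" "t \<in> {0..T}"
  shows "v x t = u x t"
proof -
  let ?I = "{-1..0::real}" and ?J = "{0<..<T}"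
  define W where "W j x t = (Dx_on (-1) 0 ^^ j) u x t - (Dx_on (-1) 0 ^^ j) v x t" for j x t
  define Wt where "Wt x t = Dt_on 0 T u x t - Dt_on 0 T v x t" for x t
  define E where "E t = integral ?I (\<lambda>x. (W 0 x t)\<^sup>2)" for t
  define G where "G x t = - (W 0 x t)\<^sup>2 - 2 * W 0 x t * W 2 x t + (W 1 x t)\<^sup>2
     + 2 * W 0 x t * W 4 x t - 2 * W 1 x t * W 3 x t + (W 2 x t)\<^sup>2" for x t
  have dW: "((\<lambda>y. W j y t) has_real_derivative W (Suc j) x t) (at x within ?I)"
    if "j < 5" "x \<in> ?I" "t \<in> ?J" for j x t
    unfolding W_def
    by (intro DERIV_diff Dx_on_funpow_has_derivative)
       (use u v that in \<open>auto simp: kawahara_solution_def\<close>)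
  have dW': "((\<lambda>y. W 0 y t) has_real_derivative W 1 x t) (at x within ?I)"
      "((\<lambda>y. W 1 y t) has_real_derivative W 2 x t) (at x within ?I)"
      "((\<lambda>y. W 2 y t) has_real_derivative W 3 x t) (at x within ?I)"
      "((\<lambda>y. W 3 y t) has_real_derivative W 4 x t) (at x within ?I)"
      "((\<lambda>y. W 4 y t) has_real_derivative W 5 x t) (at x within ?I)"
    if "x \<in> ?I" "t \<in> ?J" for x t
    using that dW[of 0] dW[of 1] dW[of 2] dW[of 3] dW[of 4] by (simp_all add: numeral_eq_Suc)
  have dt: "(W 0 x has_real_derivative Wt x t) (at t within {0..T})"
    if "x \<in> ?I" "t \<in> ?J" for x t
  proof -
    have "W 0 x = (\<lambda>t. u x t - v x t)" by (auto simp: W_def)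
    then show ?thesis
      unfolding Wt_def using that u v
      by (auto intro!: DERIV_diff Dt_on_has_derivative simp: kawahara_solution_def)
  qed
  have cont: "continuous_on (?I \<times> {0..T}) (\<lambda>(x, t). W 0 x t)"
    unfolding W_def using u v
    by (auto simp: kawahara_solution_def case_prod_unfold intro!: continuous_on_diff)
  have contt: "continuous_on (?I \<times> ?J) (\<lambda>(x, t). Wt x t)"
    unfolding Wt_def using u v
    by (auto simp: kawahara_solution_def case_prod_unfold intro!: continuous_on_diff)
  have swap: "continuous_on (B \<times> A) (\<lambda>(t, x). f x t)" if "continuous_on (A \<times> B) (\<lambda>(x, t). f x t)"
    for A B :: "real set" and f :: "real \<Rightarrow> real \<Rightarrow> real"
  proof -
    have "continuous_on (B \<times> A) ((\<lambda>(x, t). f x t) \<circ> prod.swap)"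
      by (intro continuous_on_compose continuous_on_swap) (use that in \<open>simp add: product_swap\<close>)
    then show ?thesis by (simp add: o_def case_prod_unfold)
  qed
  have contx: "continuous_on ?I (\<lambda>x. W 0 x t)" if "t \<in> {0..T}" for t
    using continuous_on_compose2[OF cont, of ?I "\<lambda>x. (x, t)"] that
    by (auto simp: continuous_on_Pair continuous_on_const image_subset_iff)
  have pde: "Wt x t = - W 1 x t - W 3 x t + W 5 x t" if "x \<in> {-1<..<0}" "t \<in> ?J" for x t
  proof -
    have "Dt_on 0 T f x t + Dx_on (-1) 0 f x t
          + (Dx_on (-1) 0 ^^ 3) f x t - (Dx_on (-1) 0 ^^ 5) f x t = 0" if "f \<in> {u, v}" for f
      using u v that \<open>x \<in> {-1<..<0}\<close> \<open>t \<in> ?J\<close> by (auto simp: kawahara_solution_def)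
    from this[of u] this[of v] show ?thesis by (simp add: W_def Wt_def)
  qed
  have b: "W 0 0 t = 0" "W 1 0 t = 0" "W 2 0 t = 0" "W 0 (-1) t = 0" "W 1 (-1) t = 0"
    if "t \<in> ?J" for t
    using u v that by (simp_all add: kawahara_solution_def W_def)
  have dG: "((\<lambda>y. G y t) has_real_derivative 2 * W 0 x t * (- W 1 x t - W 3 x t + W 5 x t))
      (at x within ?I)" if "x \<in> ?I" "t \<in> ?J" for x t
    unfolding G_def
    by (rule derivative_eq_intros refl dW'[OF that])+ (simp add: algebra_simps power2_eq_square)
  have Eint: "integral ?I (\<lambda>x. 2 * W 0 x t * Wt x t) = - (W 2 (-1) t)\<^sup>2" if "t \<in> ?J" for t
  proof -
    have "((\<lambda>x. 2 * W 0 x t * (- W 1 x t - W 3 x t + W 5 x t)) has_integral (G 0 t - G (-1) t)) ?I"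
      by (rule fundamental_theorem_of_calculus)
         (use dG that in \<open>auto simp: has_real_derivative_iff_has_vector_derivative[symmetric]\<close>)
    \<comment> \<open>The equation is given on the open interval only; the two endpoints do not
      affect the integral.\<close>
    then have "((\<lambda>x. 2 * W 0 x t * Wt x t) has_integral (G 0 t - G (-1) t)) ?I"
      by (rule has_integral_spike_finite[of "{-1, 0}", rotated 2]) (use pde that in auto)
    \<comment> \<open>At 0 every term of \<open>G\<close> has a factor \<open>W 0\<close>,
      \<open>W 1\<close> or \<open>W 2\<close>, all zero there; at -1 only the square of
      \<open>W 2\<close> survives.\<close>
    moreover have "G 0 t - G (-1) t = - (W 2 (-1) t)\<^sup>2"
      using b[OF that] by (simp add: G_def)
    ultimately show ?thesis by (simp add: integral_unique)
  qed
  have "(E has_real_derivative integral ?I (\<lambda>x. 2 * W 0 x t * Wt x t)) (at t within ?J)"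
    if "t \<in> ?J" for t
    unfolding E_def box_real(2)[symmetric]
  proof (rule leibniz_rule_field_derivative[where U = ?J])
    fix t x assume t: "t \<in> ?J" and x: "x \<in> cbox (-1) (0::real)"
    have "(W 0 x has_real_derivative Wt x t) (at t within ?J)"
      by (rule has_field_derivative_subset[OF dt]) (use t x in auto)
    then show "((\<lambda>t. (W 0 x t)\<^sup>2) has_real_derivative 2 * W 0 x t * Wt x t) (at t within ?J)"
      by (auto intro!: derivative_eq_intros)
  next
    fix t assume "t \<in> ?J"
    then show "(\<lambda>x. (W 0 x t)\<^sup>2) integrable_on cbox (-1) 0"
      using contx[of t] by (intro integrable_continuous) (auto intro!: continuous_intros)
  next
    have "continuous_on (?J \<times> ?I) (\<lambda>(t, x). W 0 x t)"
      by (rule swap, rule continuous_on_subset[OF cont]) auto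
    then show "continuous_on (?J \<times> cbox (-1) 0) (\<lambda>(t, x). 2 * W 0 x t * Wt x t)"
      using swap[OF contt] by (auto simp: case_prod_unfold intro!: continuous_intros)
  qed (use that in auto)
  then have dE: "(E has_real_derivative - (W 2 (-1) t)\<^sup>2) (at t)" if "t \<in> ?J" for t
    using that Eint[OF that] by (metis at_within_open open_greaterThanLessThan)
  have cE: "continuous_on {0..T} E"
    unfolding E_def box_real(2)[symmetric]
    by (rule integral_continuous_on_param)
       (use swap[OF cont] in \<open>auto simp: case_prod_unfold intro!: continuous_intros\<close>)
  \<comment> \<open>The derivative of \<open>E\<close> is known on the open time interval;
    continuity extends the monotonicity to the closed one.\<close>
  have "E t \<le> E 0"
    using DERIV_nonpos_imp_decreasing_open[of 0 t E] dE assms(5) continuous_on_subset[OF cE, of "{0..t}"]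
    by (force intro: exI[of _ "- (W 2 (-1) s)\<^sup>2" for s])
  also have "E 0 = integral ?I (\<lambda>x. 0)"
    unfolding E_def
    by (rule integral_spike[of "{-1, 0}"]) (use u v in \<open>auto simp: W_def kawahara_solution_def\<close>)
  finally have "E t \<le> 0" by simp
  moreover have "E t \<ge> 0"
    unfolding E_def by (rule integral_nonneg)
      (use contx[OF assms(5)] in \<open>auto intro!: integrable_continuous_real continuous_intros\<close>)
  ultimately have "integral ?I (\<lambda>x. (W 0 x t)\<^sup>2) = 0" by (simp add: E_def)
  \<comment> \<open>A continuous nonnegative function with zero integral vanishes everywhere,
    endpoints included.\<close>
  then have "(W 0 x t)\<^sup>2 = 0"
    using integral_eq_0_iff[OF continuous_on_power[OF contx[OF assms(5)]], of 2] assms(4) by auto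
  then show ?thesis by (simp add: W_def)
qed

section \<open>A Borel--Laplace transform\<close>

text \<open>The set where \<open>g\<close> is nonzero is relatively open, so continuity there is
  assumed; at a zero of \<open>g\<close> the bound squeezes \<open>f\<close> to 0. This handles the
  singular end \<open>v = 0\<close> of the logarithmic substitution below.\<close>

lemma continuous_on_vanishing:
  fixes f g :: "'a::metric_space \<Rightarrow> real"
  assumes f: "continuous_on (S \<inter> {p. g p \<noteq> 0}) f" and g: "continuous_on S g"
    and bd: "\<And>p. p \<in> S \<Longrightarrow> \<bar>f p\<bar> \<le> M * \<bar>g p\<bar>"
  shows "continuous_on S f"
  unfolding continuous_on_def
proof
  fix p assume p: "p \<in> S"
  show "(f \<longlongrightarrow> f p) (at p within S)"
  proof (cases "g p = 0")
    case True
    have "(g \<longlongrightarrow> 0) (at p within S)" using g p True by (metis continuous_on_def)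
    then have "((\<lambda>x. M * \<bar>g x\<bar>) \<longlongrightarrow> 0) (at p within S)"
      by (intro tendsto_eq_intros) auto
    moreover have "eventually (\<lambda>x. norm (f x) \<le> M * \<bar>g x\<bar>) (at p within S)"
      using bd by (auto simp: eventually_at_filter)
    ultimately have "(f \<longlongrightarrow> 0) (at p within S)" by (rule Lim_null_comparison[rotated])
    with bd[OF p] True show ?thesis by simp
  next
    case False
    obtain U where U: "open U" "S \<inter> {p. g p \<noteq> 0} = S \<inter> U"
    proof -
      have "openin (top_of_set S) (S \<inter> g -` (- {0}))"
        by (rule continuous_openin_preimage_gen[OF g]) auto
      then show ?thesis by (auto simp: openin_open vimage_def intro: that)
    qed
    have "(f \<longlongrightarrow> f p) (at p within (S \<inter> U))"
      using f p False U by (auto simp: continuous_on_def)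
    also have "at p within (S \<inter> U) = at p within S"
      by (rule at_within_nhd[of p U]) (use U p False in auto)
    finally show ?thesis .
  qed
qed

text \<open>A single term of the exponential series of \<open>b * s\<close> is at most the whole
  sum. The factorials in the Laplace, cutoff and reachable-state bounds all come from here.\<close>

lemma power_exp_le:
  fixes s b :: real
  assumes "b > 0" "s \<ge> 0" shows "s ^ k * exp (- (b * s)) \<le> fact k / b ^ k"
proof -
  have "(b * s) ^ k / fact k \<le> exp (b * s)"
  proof -
    have "(b * s) ^ k /\<^sub>R fact k = (\<Sum>i\<in>{k}. (b * s) ^ i /\<^sub>R fact i)" by simp
    also have "\<dots> \<le> (\<Sum>i. (b * s) ^ i /\<^sub>R fact i)"
      using assms by (intro sum_le_suminf summable_exp_generic) auto
    also have "\<dots> = exp (b * s)" by (simp add: exp_def)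
    also have "(b * s) ^ k /\<^sub>R fact k = (b * s) ^ k / fact k"
      by (simp add: divide_inverse mult.commute)
    finally show ?thesis .
  qed
  then show ?thesis using assms
    by (simp add: exp_minus field_simps power_mult_distrib)
qed

text \<open>For \<open>Re w > 0\<close> this is the integral of \<open>r^k * exp (- (w * r))\<close>
  over \<open>r\<close> from \<open>s\<close> to infinity, defined through its integration-by-parts
  recursion so that no improper integral occurs.\<close>

fun laplace_tail :: "complex \<Rightarrow> nat \<Rightarrow> real \<Rightarrow> complex" where
  "laplace_tail w 0 s = exp (- (w * of_real s)) / w"
| "laplace_tail w (Suc k) s =
    (of_real s ^ Suc k * exp (- (w * of_real s)) + of_nat (Suc k) * laplace_tail w k s) / w"

lemma laplace_tail_0: "w \<noteq> 0 \<Longrightarrow> laplace_tail w k 0 = fact k / w ^ Suc k"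
  by (induction k) (auto simp: field_simps)

lemma laplace_tail_has_derivative:
  "w \<noteq> 0 \<Longrightarrow> (laplace_tail w k has_vector_derivative - (of_real s ^ k * exp (- (w * of_real s)))) (at s)"
proof (induction k)
  case 0
  have e: "((\<lambda>s. exp (- (w * of_real s))) has_vector_derivative - w * exp (- (w * of_real s))) (at s)"
    by (rule has_vector_derivative_real_field) (auto intro!: derivative_eq_intros)
  have "((\<lambda>s. exp (- (w * of_real s)) / w) has_vector_derivative - w * exp (- (w * of_real s)) / w) (at s)"
    using has_vector_derivative_divide[OF e] by blast
  moreover have "laplace_tail w 0 = (\<lambda>s. exp (- (w * of_real s)) / w)" by auto
  ultimately show ?case using 0 by simp
next
  case (Suc k)
  have e: "((\<lambda>s. of_real s ^ Suc k * exp (- (w * of_real s))) has_vector_derivative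
      of_nat (Suc k) * of_real s ^ k * exp (- (w * of_real s))
      - w * of_real s ^ Suc k * exp (- (w * of_real s))) (at s)"
    by (rule has_vector_derivative_real_field)
       (auto intro!: derivative_eq_intros simp del: power_Suc of_nat_Suc simp: algebra_simps)
  have "((\<lambda>s. (of_real s ^ Suc k * exp (- (w * of_real s)) + of_nat (Suc k) * laplace_tail w k s) / w)
      has_vector_derivative (of_nat (Suc k) * of_real s ^ k * exp (- (w * of_real s))
      - w * of_real s ^ Suc k * exp (- (w * of_real s))
      + of_nat (Suc k) * - (of_real s ^ k * exp (- (w * of_real s)))) / w) (at s)"
    by (intro has_vector_derivative_divide has_vector_derivative_add e
        has_vector_derivative_mult_right Suc)
  moreover have "laplace_tail w (Suc k) =
      (\<lambda>s. (of_real s ^ Suc k * exp (- (w * of_real s)) + of_nat (Suc k) * laplace_tail w k s) / w)"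
    by auto
  ultimately show ?case using Suc.prems by (simp add: field_simps)
qed

text \<open>The decay rate is split as 7/5 = 5/4 + 3/20. The part 5/4 pays for the factorial bound;
  the rest leaves two factors \<open>exp (- (3/40 * s))\<close>, one for the Jacobian of the later
  substitution and one for vanishing at its singular end.\<close>

lemma norm_exp_mult_le:
  assumes "Re w \<ge> 7/5" "s \<ge> 0"
  shows "norm (of_real s ^ k * exp (- (w * of_real s))) \<le> fact k / (5/4) ^ k * exp (- (3/40 * s)) ^ 2"
proof -
  have "norm (of_real s ^ k * exp (- (w * of_real s))) = s ^ k * exp (- (Re w * s))"
    using assms by (simp add: norm_mult norm_power)
  also have "\<dots> \<le> s ^ k * exp (- (5/4 * s) - (3/20 * s))"
    using assms by (intro mult_left_mono) (auto intro!: mult_right_mono[of "7/5" "Re w" s, simplified])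
  also have "\<dots> = s ^ k * exp (- (5/4 * s)) * exp (- (3/40 * s)) ^ 2"
    by (simp add: mult.assoc mult_exp_exp flip: exp_double)
  also have "\<dots> \<le> fact k / (5/4) ^ k * exp (- (3/40 * s)) ^ 2"
    by (intro mult_right_mono power_exp_le assms) auto
  finally show ?thesis .
qed

text \<open>Only the decay matters, so \<open>M\<close> may depend on \<open>w\<close> and
  \<open>k\<close>: it shows that the antiderivative vanishes at infinity.\<close>

lemma norm_laplace_tail_le:
  assumes "Re w \<ge> 7/5"
  shows "\<exists>M. \<forall>s\<ge>0. norm (laplace_tail w k s) \<le> M * exp (- (3/40 * s))"
proof -
  have w: "norm w \<ge> 1" using assms complex_Re_le_cmod[of w] by linarith
  have *: "norm (of_real s ^ k * exp (- (w * of_real s))) \<le> fact k / (5/4) ^ k * exp (- (3/40 * s))"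
    if "s \<ge> 0" for s k
  proof -
    have "exp (- (3/40 * s)) ^ 2 \<le> exp (- (3/40 * s))"
      using that by (simp add: power2_eq_square mult_left_le)
    then have "fact k / (5/4) ^ k * exp (- (3/40 * s)) ^ 2 \<le> fact k / (5/4) ^ k * exp (- (3/40 * s))"
      by (intro mult_left_mono) auto
    with norm_exp_mult_le[OF assms that, of k] show ?thesis by linarith
  qed
  have dw: "norm (z / w) \<le> norm z" for z
    using w by (simp add: norm_divide divide_le_eq mult_left_le order_trans[OF _ mult_left_mono[OF w norm_ge_zero], simplified])
  show ?thesis
  proof (induction k)
    case 0
    show ?case
    proof (intro exI[of _ 1] allI impI)
      fix s :: real assume "s \<ge> 0"
      from dw[of "exp (- (w * of_real s))"] *[OF this, of 0]
      show "norm (laplace_tail w 0 s) \<le> 1 * exp (- (3/40 * s))"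
        by (simp del: norm_exp_eq_Re)
    qed
  next
    case (Suc k)
    then obtain M where M: "\<And>s. s \<ge> 0 \<Longrightarrow> norm (laplace_tail w k s) \<le> M * exp (- (3/40 * s))" by blast
    show ?case
    proof (intro exI[of _ "fact (Suc k) / (5/4) ^ Suc k + real (Suc k) * M"] allI impI)
      fix s :: real assume s: "s \<ge> 0"
      have "norm (laplace_tail w (Suc k) s)
          \<le> norm (of_real s ^ Suc k * exp (- (w * of_real s)) + of_nat (Suc k) * laplace_tail w k s)"
        unfolding laplace_tail.simps by (rule dw)
      also have "\<dots> \<le> norm (of_real s ^ Suc k * exp (- (w * of_real s)))
          + norm (of_nat (Suc k) * laplace_tail w k s)"
        by (rule norm_triangle_ineq)
      also have "norm (of_nat (Suc k) * laplace_tail w k s) \<le> real (Suc k) * (M * exp (- (3/40 * s)))"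
        unfolding norm_mult norm_of_nat by (intro mult_left_mono M s) auto
      also note *[OF s, of "Suc k"]
      finally show "norm (laplace_tail w (Suc k) s)
          \<le> (fact (Suc k) / (5/4) ^ Suc k + real (Suc k) * M) * exp (- (3/40 * s))"
        by (simp add: algebra_simps)
    qed
  qed
qed

section \<open>Fourier coefficients over a fifth of a circle\<close>

lemma has_integral_cos_multiple:
  fixes m :: int
  shows "((\<lambda>\<theta>. cos (5 * of_int m * \<theta>)) has_integral (if m = 0 then 2 * pi / 5 else 0)) {- (pi/5)..pi/5}"
proof (cases "m = 0")
  case True
  then show ?thesis using has_integral_const_real[of "1::real" "-(pi/5)" "pi/5"] by simp
next
  case False
  have "((\<lambda>\<theta>. cos (5 * of_int m * \<theta>)) has_integral
      (sin (5 * m * (pi/5)) / (5 * m) - sin (5 * m * (- (pi/5))) / (5 * m))) {- (pi/5)..pi/5}"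
    by (rule fundamental_theorem_of_calculus)
       (use False in \<open>auto intro!: derivative_eq_intros simp flip: has_real_derivative_iff_has_vector_derivative\<close>)
  \<comment> \<open>Frequencies divisible by 5 complete whole periods on an arc of length
    \<open>2 * pi / 5\<close>, so orthogonality survives on this short arc.\<close>
  moreover have "sin (5 * m * (pi/5)) = 0" using sin_int_times_real[of 1] by (simp add: sin_zero_iff_int2)
  ultimately show ?thesis using False by simp
qed

text \<open>These are the boundary values, on a circle, of a power series in \<open>w^5\<close>,
  with the powers of the radius absorbed into \<open>c\<close>.\<close>

definition fourier5 :: "(nat \<Rightarrow> real) \<Rightarrow> real \<Rightarrow> complex" where
  "fourier5 c \<theta> = (\<Sum>j. of_real (c j) * cis (5 * real j * \<theta>))"

lemma continuous_on_fourier5: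
  assumes "summable (\<lambda>j. \<bar>c j\<bar>)"
  shows "continuous_on S (fourier5 c)"
proof (rule uniform_limit_theorem[OF _ _ trivial_limit_sequentially])
  show "uniform_limit S (\<lambda>n \<theta>. \<Sum>j<n. of_real (c j) * cis (5 * real j * \<theta>)) (fourier5 c) sequentially"
    unfolding fourier5_def
    by (rule Weierstrass_m_test[OF _ assms]) (simp add: norm_mult)
qed (auto intro!: always_eventually continuous_intros)

text \<open>The factor \<open>cis (- (5 * real n * \<theta>))\<close> shifts all frequencies by
  \<open>n\<close>, so only the term \<open>j = n\<close> has a nonzero integral; absolute
  summability gives the uniform convergence needed to integrate termwise.\<close>

lemma has_integral_fourier5:
  assumes c: "summable (\<lambda>j. \<bar>c j\<bar>)"
  shows "((\<lambda>\<theta>. Re (fourier5 c \<theta> * cis (- (5 * real n * \<theta>)))) has_integral 2 * pi / 5 * c n)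
    {- (pi/5)..pi/5}"
proof -
  define f where "f N \<theta> = (\<Sum>j<N. c j * cos (5 * of_int (int j - int n) * \<theta>))" for N \<theta>
  have eq: "Re (fourier5 c \<theta> * cis (- (5 * real n * \<theta>)))
      = (\<Sum>j. c j * cos (5 * of_int (int j - int n) * \<theta>))" for \<theta> :: real
  proof -
    have s: "summable (\<lambda>j. of_real (c j) * cis (5 * real j * \<theta>))"
      by (rule summable_norm_cancel) (use c in \<open>simp add: norm_mult\<close>)
    have "fourier5 c \<theta> * cis (- (5 * real n * \<theta>))
        = (\<Sum>j. of_real (c j) * cis (5 * real j * \<theta>) * cis (- (5 * real n * \<theta>)))"
      unfolding fourier5_def by (rule suminf_mult2[OF s])
    also have "Re \<dots> = (\<Sum>j. Re (of_real (c j) * cis (5 * real j * \<theta>) * cis (- (5 * real n * \<theta>))))"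
      by (rule bounded_linear.suminf[OF bounded_linear_Re summable_mult2[OF s]])
    also have "\<dots> = (\<Sum>j. c j * cos (5 * of_int (int j - int n) * \<theta>))"
      by (simp add: mult.assoc cis_mult algebra_simps)
    finally show ?thesis .
  qed
  have "uniform_limit (cbox (- (pi/5)) (pi/5)) f
      (\<lambda>\<theta>. Re (fourier5 c \<theta> * cis (- (5 * real n * \<theta>)))) sequentially"
    unfolding f_def eq
    by (rule Weierstrass_m_test[OF _ c]) (simp add: abs_mult mult_left_le)
  then obtain I J where I: "\<And>N. (f N has_integral I N) (cbox (- (pi/5)) (pi/5))"
    and J: "((\<lambda>\<theta>. Re (fourier5 c \<theta> * cis (- (5 * real n * \<theta>)))) has_integral J) (cbox (- (pi/5)) (pi/5))"
    and lim: "I \<longlonglongrightarrow> J"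
    by (rule uniform_limit_integral_cbox) (auto simp: f_def intro!: continuous_intros)
  have "(f N has_integral (\<Sum>j<N. c j * (if int j - int n = 0 then 2 * pi / 5 else 0))) (cbox (- (pi/5)) (pi/5))" for N
    unfolding f_def box_real
    by (intro has_integral_sum has_integral_mult_right has_integral_cos_multiple) auto
  then have "I N = (\<Sum>j<N. c j * (if int j - int n = 0 then 2 * pi / 5 else 0))" for N
    using I has_integral_unique by blast
  also have "\<dots> N = (\<Sum>j<N. if j = n then 2 * pi / 5 * c n else 0)" for N
    by (intro sum.cong) auto
  finally have "I N = (\<Sum>j<N. if j = n then 2 * pi / 5 * c n else 0)" for N .
  \<comment> \<open>The integrals of the partial sums are constant from \<open>N = n + 1\<close> on,
    which identifies their limit.\<close>
  then have "I N = 2 * pi / 5 * c n" if "N > n" for N using that by (simp add: sum.delta)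
  then have "eventually (\<lambda>N. I N = 2 * pi / 5 * c n) sequentially"
    by (rule eventually_mono[OF eventually_gt_at_top[of n]])
  then have "J = 2 * pi / 5 * c n"
    using lim tendsto_eventually LIMSEQ_unique by blast
  then show ?thesis using J by (simp only: box_real)
qed

section \<open>The kernel of the transform on the arc\<close>

lemma Re_cis_arc_ge:
  assumes "\<theta> \<in> {- (pi/5)..pi/5}" shows "Re (of_real (14/5) * cis \<theta>) \<ge> 7/5"
proof -
  \<comment> \<open>The arc is contained in the sector of half-angle \<open>pi/3\<close>, where the
    cosine is at least 1/2; half of 14/5 is 7/5.\<close>
  have "cos (pi/3) \<le> cos \<bar>\<theta>\<bar>" using assms by (intro cos_monotone_0_pi_le) auto
  then show ?thesis by (simp add: cos_60)
qed

text \<open>The Borel--Laplace kernel after the substitution \<open>s = - ln v / (3/40)\<close>, which makes the domain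
  of integration compact; at \<open>v = 0\<close> the division yields the correct limit \<open>0\<close>.\<close>

definition borel_kernel :: "(real \<Rightarrow> complex) \<Rightarrow> nat \<Rightarrow> real \<Rightarrow> real \<times> real \<Rightarrow> real" where
  "borel_kernel A n \<tau> = (\<lambda>(\<theta>, v). let s = - ln v / (3/40) in
     Re (A \<theta> * exp (- (of_real (14/5) * cis \<theta> * of_real s))) / (3/40 * v) * (- (s ^ 5)) ^ n * exp (- (s ^ 5 * \<tau>)))"

lemma borel_kernel_eq:
  assumes "s = - ln v / (3/40)" "w = of_real (14/5) * cis \<theta>"
  shows "borel_kernel A n \<tau> (\<theta>, v) =
    Re (A \<theta> * exp (- (w * of_real s))) / (3/40 * v) * (- (s ^ 5)) ^ n * exp (- (s ^ 5 * \<tau>))"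
  by (simp only: borel_kernel_def Let_def assms prod.case)

abbreviation borel_box :: "(real \<times> real) set" where
  "borel_box \<equiv> cbox (- (pi/5), 0) (pi/5, 1)"

text \<open>With \<open>v = exp (- (3/40 * s))\<close>, the bound \<open>norm_exp_mult_le\<close>
  supplies \<open>v^2\<close>; the Jacobian \<open>1 / (3/40 * v)\<close> consumes one power and the
  other makes the kernel continuous at \<open>v = 0\<close>.\<close>

lemma abs_borel_kernel_le:
  assumes A: "\<And>\<theta>. \<theta> \<in> {- (pi/5)..pi/5} \<Longrightarrow> norm (A \<theta>) \<le> M"
    and p: "(\<theta>, v) \<in> borel_box" and "\<tau> \<ge> 0"
  shows "\<bar>borel_kernel A n \<tau> (\<theta>, v)\<bar> \<le> M / (3/40) * (fact (5 * n) / (5/4) ^ (5 * n)) * v"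
proof (cases "v = 0")
  case False
  define s where "s = - ln v / (3/40)"
  define w where "w = of_real (14/5) * cis \<theta>"
  have v: "0 < v" "v \<le> 1" and \<theta>: "\<theta> \<in> {- (pi/5)..pi/5}" using p False by auto
  then have s: "s \<ge> 0" by (simp add: s_def)
  have ev: "exp (- (3/40 * s)) = v" using v by (simp add: s_def)
  have M: "M \<ge> 0" using A[OF \<theta>] norm_ge_zero order_trans by blast
  have "\<bar>borel_kernel A n \<tau> (\<theta>, v)\<bar>
      = \<bar>Re (A \<theta> * exp (- (w * of_real s)))\<bar> * s ^ (5 * n) / (3/40 * v) * exp (- (s ^ 5 * \<tau>))"
    using s v by (subst borel_kernel_eq[OF s_def w_def]) (simp add: abs_mult power_abs power_mult del: times_complex.sel)
  also have "\<dots> \<le> \<bar>Re (A \<theta> * exp (- (w * of_real s)))\<bar> * s ^ (5 * n) / (3/40 * v)"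
    using s v \<open>\<tau> \<ge> 0\<close> by (intro mult_left_le) auto
  also have "\<dots> \<le> norm (A \<theta>) * norm (of_real s ^ (5 * n) * exp (- (w * of_real s))) / (3/40 * v)"
  proof (intro divide_right_mono)
    have "\<bar>Re (A \<theta> * exp (- (w * of_real s)))\<bar> * s ^ (5 * n)
        \<le> norm (A \<theta> * exp (- (w * of_real s))) * s ^ (5 * n)"
      by (intro mult_right_mono abs_Re_le_cmod) (use s in auto)
    also have "\<dots> = norm (A \<theta>) * norm (of_real s ^ (5 * n) * exp (- (w * of_real s)))"
      using s by (simp add: norm_mult norm_power del: norm_exp_eq_Re)
    finally show "\<bar>Re (A \<theta> * exp (- (w * of_real s)))\<bar> * s ^ (5 * n)
        \<le> norm (A \<theta>) * norm (of_real s ^ (5 * n) * exp (- (w * of_real s)))" .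
  qed (use v in auto)
  also have "\<dots> \<le> M * (fact (5 * n) / (5/4) ^ (5 * n) * v ^ 2) / (3/40 * v)"
    using norm_exp_mult_le[of w s "5 * n"] Re_cis_arc_ge[OF \<theta>] s ev v M
    by (intro divide_right_mono mult_mono A[OF \<theta>]) (auto simp: w_def)
  also have "\<dots> = M / (3/40) * (fact (5 * n) / (5/4) ^ (5 * n)) * v"
    using v by (simp add: power2_eq_square)
  finally show ?thesis .
qed (simp add: borel_kernel_def)

lemma continuous_on_borel_kernel:
  assumes A: "continuous_on {- (pi/5)..pi/5} A"
  shows "continuous_on ({0..} \<times> borel_box) (\<lambda>(\<tau>, p). borel_kernel A n \<tau> p)"
proof -
  have "compact (A ` {- (pi/5)..pi/5})" by (rule compact_continuous_image[OF A]) auto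
  then obtain M where M: "\<And>\<theta>. \<theta> \<in> {- (pi/5)..pi/5} \<Longrightarrow> norm (A \<theta>) \<le> M"
    by (meson bounded_iff compact_imp_bounded imageI)
  show ?thesis
  proof (rule continuous_on_vanishing[where g = "\<lambda>(\<tau>, p). snd p"
      and M = "M / (3/40) * (fact (5 * n) / (5/4) ^ (5 * n))"])
    show "continuous_on (({0..} \<times> borel_box) \<inter> {p. (case p of (\<tau>, p) \<Rightarrow> snd p) \<noteq> 0})
        (\<lambda>(\<tau>, p). borel_kernel A n \<tau> p)"
      unfolding borel_kernel_def Let_def case_prod_unfold
      by (intro continuous_intros continuous_on_compose2[OF A]) auto
    show "continuous_on ({0::real..} \<times> borel_box) (\<lambda>(\<tau>, p). snd p)"
      unfolding case_prod_unfold by (intro continuous_intros)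
    fix q assume "q \<in> {0::real..} \<times> borel_box"
    then show "\<bar>case q of (\<tau>, p) \<Rightarrow> borel_kernel A n \<tau> p\<bar>
        \<le> M / (3/40) * (fact (5 * n) / (5/4) ^ (5 * n)) * \<bar>case q of (\<tau>, p) \<Rightarrow> snd p\<bar>"
      using abs_borel_kernel_le[of A M _ _ _ n] M by (cases q) (force simp: cbox_Pair_eq)
  qed
qed

text \<open>Each derivative in \<open>\<tau>\<close> brings down a factor \<open>- (s^5)\<close>,
  which is why \<open>n\<close> enters the kernel as a power of it.\<close>

lemma borel_kernel_has_derivative:
  "((\<lambda>\<tau>. borel_kernel A n \<tau> p) has_real_derivative borel_kernel A (Suc n) \<tau> p) (at \<tau> within S)"
proof -
  have "((\<lambda>\<tau>. a * (- b) ^ n * exp (- (b * \<tau>))) has_real_derivative a * (- b) ^ Suc n * exp (- (b * \<tau>)))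
      (at \<tau> within S)" for a b :: real
    by (rule derivative_eq_intros refl)+ simp
  then show ?thesis unfolding borel_kernel_def Let_def case_prod_unfold .
qed

text \<open>After the substitution the integrand is the derivative of a Laplace tail. The end
  \<open>v = 1\<close> is \<open>s = 0\<close>, where the tail is
  \<open>fact (5 * n) / w ^ Suc (5 * n)\<close>; the end \<open>v = 0\<close> is \<open>s\<close> at
  infinity, where it vanishes.\<close>

lemma integral_borel_kernel_0:
  assumes \<theta>: "\<theta> \<in> {- (pi/5)..pi/5}"
    and w_def: "w = of_real (14/5) * cis \<theta>"
  shows "((\<lambda>v. borel_kernel A n 0 (\<theta>, v)) has_integral
    (- 1) ^ n * fact (5 * n) * Re (A \<theta> / w ^ Suc (5 * n))) {0..1}"
proof -
  define s where "s v = - ln v / (3/40)" for v :: real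
  \<comment> \<open>The value at \<open>v = 0\<close> is set by hand to the limit 0, as no real
    \<open>s\<close> corresponds to it.\<close>
  define H where "H v = (if v = 0 then 0 else (- 1) ^ n * Re (A \<theta> * laplace_tail w (5 * n) (s v)))" for v
  have w: "Re w \<ge> 7/5" unfolding w_def by (rule Re_cis_arc_ge[OF \<theta>])
  then have w0: "w \<noteq> 0" by auto
  obtain M where M: "\<And>s. s \<ge> 0 \<Longrightarrow> norm (laplace_tail w (5 * n) s) \<le> M * exp (- (3/40 * s))"
    using norm_laplace_tail_le[OF w] by blast
  have dH: "(H has_real_derivative borel_kernel A n 0 (\<theta>, v)) (at v)" if "v > 0" for v
  proof -
    have s: "(s has_real_derivative - (1 / (3/40 * v))) (at v)"
      unfolding s_def using that by (auto intro!: derivative_eq_intros simp: field_simps)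
    have "(laplace_tail w (5 * n) \<circ> s has_vector_derivative
        - (1 / (3/40 * v)) *\<^sub>R - (of_real (s v) ^ (5 * n) * exp (- (w * of_real (s v))))) (at v)"
      by (rule vector_diff_chain_at)
         (use s laplace_tail_has_derivative[OF w0] in \<open>auto simp: has_real_derivative_iff_has_vector_derivative\<close>)
    then have "((\<lambda>v. (- 1) ^ n * Re (A \<theta> * laplace_tail w (5 * n) (s v))) has_vector_derivative
        (- 1) ^ n * Re (A \<theta> * (- (1 / (3/40 * v)) *\<^sub>R - (of_real (s v) ^ (5 * n) * exp (- (w * of_real (s v))))))) (at v)"
      unfolding o_def
      by (intro has_vector_derivative_mult_right bounded_linear.has_vector_derivative[OF bounded_linear_Re])
    moreover have "(- 1) ^ n * Re (A \<theta> * (- (1 / (3/40 * v)) *\<^sub>R - (of_real (s v) ^ (5 * n) * exp (- (w * of_real (s v))))))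
       = borel_kernel A n 0 (\<theta>, v)"
    proof -
      have "A \<theta> * (- (1 / (3/40 * v)) *\<^sub>R - (of_real (s v) ^ (5 * n) * exp (- (w * of_real (s v)))))
         = of_real (s v ^ (5 * n) / (3/40 * v)) * (A \<theta> * exp (- (w * of_real (s v))))"
        by (simp add: scaleR_conv_of_real algebra_simps)
      then have "Re (A \<theta> * (- (1 / (3/40 * v)) *\<^sub>R - (of_real (s v) ^ (5 * n) * exp (- (w * of_real (s v))))))
         = s v ^ (5 * n) / (3/40 * v) * Re (A \<theta> * exp (- (w * of_real (s v))))"
        by (simp only: Re_complex_of_real Im_complex_of_real times_complex.sel mult_zero_left diff_zero)
      moreover have "(- (s v ^ 5)) ^ n = (- 1) ^ n * s v ^ (5 * n)"
        by (simp add: power_minus[of "s v ^ 5"] power_mult)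
      ultimately show ?thesis
        by (subst borel_kernel_eq[OF s_def[of v] w_def]) (simp add: algebra_simps del: times_complex.sel)
    qed
    ultimately have "((\<lambda>v. (- 1) ^ n * Re (A \<theta> * laplace_tail w (5 * n) (s v)))
        has_real_derivative borel_kernel A n 0 (\<theta>, v)) (at v)"
      by (simp add: has_real_derivative_iff_has_vector_derivative)
    then show ?thesis
      by (rule has_field_derivative_transform_within[where d = v]) (use that in \<open>auto simp: H_def dist_real_def\<close>)
  qed
  have cH: "continuous_on {0..1} H"
  proof (rule continuous_on_vanishing[where g = "\<lambda>v. v" and M = "norm (A \<theta>) * M"])
    show "continuous_on ({0..1} \<inter> {p. p \<noteq> 0}) H"
      by (rule DERIV_continuous_on[where D = "\<lambda>v. borel_kernel A n 0 (\<theta>, v)"])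
         (use dH in \<open>force intro: has_field_derivative_at_within\<close>)
    fix v :: real assume v: "v \<in> {0..1}"
    show "\<bar>H v\<bar> \<le> norm (A \<theta>) * M * \<bar>v\<bar>"
    proof (cases "v = 0")
      case False
      with v have "s v \<ge> 0" "exp (- (3/40 * s v)) = v" by (auto simp: s_def)
      with M[of "s v"] have le: "norm (laplace_tail w (5 * n) (s v)) \<le> M * v" by simp
      have "\<bar>H v\<bar> = \<bar>Re (A \<theta> * laplace_tail w (5 * n) (s v))\<bar>"
        using False by (simp add: H_def abs_mult)
      also have "\<dots> \<le> norm (A \<theta>) * norm (laplace_tail w (5 * n) (s v))"
        using abs_Re_le_cmod norm_mult by metis
      also have "\<dots> \<le> norm (A \<theta>) * (M * v)" by (intro mult_left_mono le) auto
      finally show ?thesis using v by simp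
    qed (simp add: H_def)
  qed (auto intro: continuous_intros)
  have "((\<lambda>v. borel_kernel A n 0 (\<theta>, v)) has_integral (H 1 - H 0)) {0..1}"
    by (rule fundamental_theorem_of_calculus_interior)
       (use dH cH in \<open>auto simp: has_real_derivative_iff_has_vector_derivative[symmetric]\<close>)
  moreover have "H 1 - H 0 = (- 1) ^ n * fact (5 * n) * Re (A \<theta> / w ^ Suc (5 * n))"
  proof -
    have "A \<theta> * laplace_tail w (5 * n) 0 = of_real (fact (5 * n)) * (A \<theta> / w ^ Suc (5 * n))"
      by (simp only: laplace_tail_0[OF w0]) simp
    then have "Re (A \<theta> * laplace_tail w (5 * n) 0) = fact (5 * n) * Re (A \<theta> / w ^ Suc (5 * n))"
      by (simp only: Re_complex_of_real Im_complex_of_real times_complex.sel mult_zero_left diff_zero)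
    then show ?thesis by (simp add: H_def s_def)
  qed
  ultimately show ?thesis by simp
qed

text \<open>The sign \<open>(- 1) ^ n\<close> anticipates the reflection
  \<open>\<tau> = T - t\<close>. The radius 14/5 is chosen below 3 for convergence and large enough
  that its half, 7/5, exceeds 5/4.\<close>

lemma borel_half_line:
  assumes d: "\<And>n. \<bar>d n\<bar> \<le> C * fact (5 * n) / 3 ^ (5 * n)"
  obtains F M where "jets F {0..}" "\<And>n. F n 0 = (- 1) ^ n * d n"
    "\<And>n \<tau>. \<tau> \<ge> 0 \<Longrightarrow> \<bar>F n \<tau>\<bar> \<le> M * (fact (5 * n) / (5/4) ^ (5 * n))"
proof -
  \<comment> \<open>\<open>c\<close> holds the Taylor coefficients of \<open>D\<close> on the circle
    of radius 14/5, dominated by powers of \<open>(14/15) ^ 5\<close>. The factor \<open>w\<close>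
    in \<open>A\<close> cancels the surplus power in \<open>fact (5 * n) / w ^ Suc (5 * n)\<close>,
    and the prefactor of \<open>F\<close> is the inverse length of the arc.\<close>
  define c where "c n = d n * (14/5) ^ (5 * n) / fact (5 * n)" for n
  define A where "A \<theta> = fourier5 c \<theta> * (of_real (14/5) * cis \<theta>)" for \<theta>
  define F where "F n \<tau> = 5 / (2 * pi) * integral borel_box (borel_kernel A n \<tau>)" for n \<tau>
  have c: "summable (\<lambda>j. \<bar>c j\<bar>)"
  proof (rule summable_comparison_test')
    show "summable (\<lambda>n. C * ((14/15) ^ 5) ^ n)"
      by (intro summable_mult summable_geometric) (simp add: power_divide)
    fix n
    have "\<bar>c n\<bar> = \<bar>d n\<bar> * (14/5) ^ (5 * n) / fact (5 * n)" by (simp add: c_def abs_mult)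
    also have "\<dots> \<le> C * fact (5 * n) / 3 ^ (5 * n) * (14/5) ^ (5 * n) / fact (5 * n)"
      by (intro divide_right_mono mult_right_mono d) auto
    also have "\<dots> = C * ((14/5) ^ (5 * n) / 3 ^ (5 * n))" by simp
    also have "(14/5) ^ (5 * n) / 3 ^ (5 * n) = ((14/15::real) ^ 5) ^ n"
      by (simp only: power_mult power_divide[symmetric]) simp
    finally show "norm \<bar>c n\<bar> \<le> C * ((14/15) ^ 5) ^ n" by simp
  qed
  have A: "continuous_on {- (pi/5)..pi/5} A"
    unfolding A_def by (intro continuous_intros continuous_on_fourier5 c)
  then have "compact (A ` {- (pi/5)..pi/5})" by (rule compact_continuous_image) auto
  then obtain M where M: "\<And>\<theta>. \<theta> \<in> {- (pi/5)..pi/5} \<Longrightarrow> norm (A \<theta>) \<le> M"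
    by (meson bounded_iff compact_imp_bounded imageI)
  have "norm (A 0) \<le> M" by (rule M) simp
  then have M0: "M \<ge> 0" by (rule order_trans[OF norm_ge_zero])
  have K: "continuous_on borel_box (borel_kernel A n \<tau>)" if "\<tau> \<ge> 0" for n \<tau>
    using continuous_on_compose2[OF continuous_on_borel_kernel[OF A], of borel_box "\<lambda>p. (\<tau>, p)" n] that
    by (auto simp: continuous_on_Pair continuous_on_const continuous_on_id image_subset_iff)
  show thesis
  proof (rule that[of F])
    show "jets F {0..}"
    proof (rule jetsI)
      fix n \<tau> assume "\<tau> \<in> {0::real..}"
      then have "((\<lambda>\<tau>. integral borel_box (borel_kernel A n \<tau>)) has_real_derivative
          integral borel_box (borel_kernel A (Suc n) \<tau>)) (at \<tau> within {0..})"
        by (intro leibniz_rule_field_derivative borel_kernel_has_derivative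
            continuous_on_borel_kernel A integrable_continuous K) auto
      then show "(F n has_real_derivative F (Suc n) \<tau>) (at \<tau> within {0..})"
        unfolding F_def by (intro DERIV_cmult)
    qed
    fix n
    have "integral borel_box (borel_kernel A n 0)
        = integral {- (pi/5)..pi/5} (\<lambda>\<theta>. integral {0..1} (\<lambda>v. borel_kernel A n 0 (\<theta>, v)))"
      using integral_prod_continuous[OF K, of 0 n] by simp
    also have "\<dots> = integral {- (pi/5)..pi/5} (\<lambda>\<theta>. (- 1) ^ n * fact (5 * n) / (14/5) ^ (5 * n)
        * Re (fourier5 c \<theta> * cis (- (5 * real n * \<theta>))))"
    proof (rule integral_cong)
      fix \<theta> assume \<theta>: "\<theta> \<in> {- (pi/5)..pi/5}"
      let ?w = "of_real (14/5) * cis \<theta>"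
      have "A \<theta> / ?w ^ Suc (5 * n) = fourier5 c \<theta> / ?w ^ (5 * n)" by (simp add: A_def)
      also have "?w ^ (5 * n) = of_real ((14/5) ^ (5 * n)) * cis (5 * real n * \<theta>)"
        by (simp only: power_mult_distrib Complex.DeMoivre of_real_power) simp
      also have "fourier5 c \<theta> / \<dots> = fourier5 c \<theta> * cis (- (5 * real n * \<theta>)) / of_real ((14/5) ^ (5 * n))"
        by (simp only: cis_inverse[symmetric] divide_inverse inverse_mult_distrib ac_simps)
      finally have "Re (A \<theta> / ?w ^ Suc (5 * n))
          = Re (fourier5 c \<theta> * cis (- (5 * real n * \<theta>))) / (14/5) ^ (5 * n)"
        by (simp only: Re_divide_of_real)
      then show "integral {0..1} (\<lambda>v. borel_kernel A n 0 (\<theta>, v)) =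
          (- 1) ^ n * fact (5 * n) / (14/5) ^ (5 * n) * Re (fourier5 c \<theta> * cis (- (5 * real n * \<theta>)))"
        using integral_unique[OF integral_borel_kernel_0[OF \<theta> refl, of A n]] by simp
    qed
    also have "\<dots> = (- 1) ^ n * fact (5 * n) / (14/5) ^ (5 * n) * (2 * pi / 5 * c n)"
      by (rule integral_unique, rule has_integral_mult_right, rule has_integral_fourier5[OF c])
    also have "\<dots> = 2 * pi / 5 * ((- 1) ^ n * d n)" by (simp add: c_def)
    finally show "F n 0 = (- 1) ^ n * d n" unfolding F_def by (simp only:) simp
  next
    fix n and \<tau> :: real assume \<tau>: "\<tau> \<ge> 0"
    let ?B = "M / (3/40) * (fact (5 * n) / (5/4) ^ (5 * n))"
    have "norm (integral borel_box (borel_kernel A n \<tau>)) \<le> ?B * measure lborel borel_box"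
    proof (rule has_integral_bound)
      show "(borel_kernel A n \<tau> has_integral integral borel_box (borel_kernel A n \<tau>)) borel_box"
        by (rule integrable_integral[OF integrable_continuous[OF K[OF \<tau>]]])
      show B: "?B \<ge> 0" using M0 by simp
      fix p assume p: "p \<in> borel_box"
      obtain \<theta> v where [simp]: "p = (\<theta>, v)" by force
      have "\<bar>borel_kernel A n \<tau> (\<theta>, v)\<bar> \<le> ?B * v"
        by (rule abs_borel_kernel_le) (use M p \<tau> in auto)
      also have "\<dots> \<le> ?B" by (rule mult_left_le[OF _ B]) (use p in auto)
      finally show "norm (borel_kernel A n \<tau> p) \<le> ?B" by simp
    qed
    then have "\<bar>F n \<tau>\<bar> \<le> 5 / (2 * pi) * (?B * measure lborel borel_box)"
      unfolding F_def abs_mult by (intro mult_mono) auto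
    then show "\<bar>F n \<tau>\<bar> \<le> (5 / (2 * pi) * (M / (3/40)) * measure lborel borel_box) * (fact (5 * n) / (5/4) ^ (5 * n))"
      by (simp only: ac_simps)
  qed
qed

section \<open>A cutoff of Gevrey order 2\<close>

text \<open>The derivatives of \<open>exp (- 1/t)\<close>, extended by 0 to \<open>t <= 0\<close>.
  Taking them in the complex plane makes Cauchy's inequality available.\<close>

definition flat_exp :: "nat \<Rightarrow> real \<Rightarrow> real" where
  "flat_exp n t = (if t > 0 then Re ((deriv ^^ n) (\<lambda>z. exp (- inverse z)) (of_real t)) else 0)"

text \<open>Cauchy's inequality on the disc of radius \<open>t/2\<close> about \<open>t\<close>: on
  its boundary \<open>Re z >= t/2\<close> and \<open>norm z <= 3/2 * t\<close>, hence
  \<open>Re (1/z) >= 2 / (9 * t)\<close>.\<close>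

lemma abs_flat_exp_le:
  assumes "t > 0"
  shows "\<bar>flat_exp n t\<bar> \<le> fact n * 2 ^ n * (inverse t ^ n * exp (- (2/9 * inverse t)))"
proof -
  have nz: "z \<noteq> 0" if "z \<in> cball (of_real t) (t/2)" for z :: complex
    using that assms by (auto simp: dist_norm)
  have "norm ((deriv ^^ n) (\<lambda>z::complex. exp (- inverse z)) (of_real t))
      \<le> fact n * exp (- (2/9 * inverse t)) / (t/2) ^ n"
  proof (rule Cauchy_inequality)
    show "continuous_on (cball (of_real t) (t/2)) (\<lambda>z::complex. exp (- inverse z))"
      by (intro continuous_intros) (use nz in auto)
    show "(\<lambda>z::complex. exp (- inverse z)) holomorphic_on ball (of_real t) (t/2)"
      by (intro holomorphic_intros) (use nz in auto)
    fix z :: complex assume z: "norm (of_real t - z) = t/2"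
    have "z \<noteq> 0" using z assms by auto
    have "\<bar>Re (of_real t - z)\<bar> \<le> t/2" using abs_Re_le_cmod[of "of_real t - z"] z by simp
    then have re: "Re z \<ge> t/2" unfolding minus_complex.sel Re_complex_of_real by linarith
    have "norm z \<le> t + t/2"
      using norm_triangle_ineq4[of "of_real t" "of_real t - z"] z assms by simp
    then have n: "(norm z)\<^sup>2 \<le> (3/2 * t)\<^sup>2" by (intro power_mono) auto
    have "Re (inverse z) = Re z / (norm z)\<^sup>2"
      by (simp add: cmod_power2)
    also have "\<dots> \<ge> (t/2) / (3/2 * t)\<^sup>2"
      using re n assms \<open>z \<noteq> 0\<close> by (intro frac_le) auto
    finally have "Re (inverse z) \<ge> 2/9 * inverse t"
      using assms by (simp add: field_simps power2_eq_square)
    then show "norm (exp (- inverse z)) \<le> exp (- (2/9 * inverse t))" by simp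
  qed (use assms in auto)
  then have "norm ((deriv ^^ n) (\<lambda>z::complex. exp (- inverse z)) (of_real t))
      \<le> fact n * 2 ^ n * (inverse t ^ n * exp (- (2/9 * inverse t)))"
    using assms by (simp add: power_divide field_simps)
  then have "\<bar>Re ((deriv ^^ n) (\<lambda>z. exp (- inverse z)) (of_real t))\<bar>
      \<le> fact n * 2 ^ n * (inverse t ^ n * exp (- (2/9 * inverse t)))"
    by (rule order_trans[OF abs_Re_le_cmod])
  then show ?thesis using assms by (simp only: flat_exp_def if_True)
qed

text \<open>The exponential absorbs \<open>k\<close> additional powers of \<open>1/t\<close>. The
  choice \<open>k = 2\<close> gives differentiability at 0, and \<open>k = 0\<close> the Gevrey
  bound of order 2.\<close>

lemma abs_flat_exp_le':
  assumes "t \<ge> 0"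
  shows "\<bar>flat_exp n t\<bar> \<le> fact n * 2 ^ n * (fact (n + k) / (2/9) ^ (n + k)) * t ^ k"
proof (cases "t = 0")
  case False
  with assms have t: "t > 0" by simp
  have "inverse t ^ n * exp (- (2/9 * inverse t)) = inverse t ^ (n + k) * exp (- (2/9 * inverse t)) * t ^ k"
    using t by (simp add: power_add field_simps)
  also have "\<dots> \<le> fact (n + k) / (2/9) ^ (n + k) * t ^ k"
    using t by (intro mult_right_mono power_exp_le) auto
  finally have "fact n * 2 ^ n * (inverse t ^ n * exp (- (2/9 * inverse t)))
      \<le> fact n * 2 ^ n * (fact (n + k) / (2/9) ^ (n + k) * t ^ k)"
    by (intro mult_left_mono) auto
  with abs_flat_exp_le[OF t, of n] show ?thesis by (simp add: mult.assoc)
qed (simp add: flat_exp_def)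

lemma abs_flat_exp_le_gevrey:
  assumes "t \<ge> 0"
  shows "\<bar>flat_exp n t\<bar> \<le> 9 ^ n * (fact n)\<^sup>2"
proof -
  have "fact n * 2 ^ n * (fact n / (2/9) ^ n) = (2 ^ n / (2/9) ^ n) * ((fact n)\<^sup>2 :: real)"
    by (simp add: power2_eq_square)
  also have "(2 ^ n / (2/9) ^ n :: real) = 9 ^ n" by (simp flip: power_divide)
  finally show ?thesis using abs_flat_exp_le'[OF assms, of n 0] by simp
qed

lemma jets_flat_exp: "jets flat_exp {0..}"
proof (rule jetsI)
  fix n t assume "t \<in> {0::real..}"
  then consider "t = 0" | "t > 0" by fastforce
  then show "(flat_exp n has_real_derivative flat_exp (Suc n) t) (at t within {0..})"
  proof cases
    case 1
    \<comment> \<open>The quadratic bound makes the difference quotient at 0 at most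
      \<open>?K * \<bar>y\<bar>\<close>, so it tends to 0.\<close>
    let ?K = "fact n * 2 ^ n * (fact (n + 2) / (2/9) ^ (n + 2)) :: real"
    have "((\<lambda>y. ?K * \<bar>y\<bar>) \<longlongrightarrow> ?K * \<bar>0\<bar>) (at 0 within {0..})"
      by (intro tendsto_intros)
    then have "((\<lambda>y. ?K * \<bar>y\<bar>) \<longlongrightarrow> 0) (at 0 within {0..})" by simp
    moreover have "norm (flat_exp n y / y) \<le> ?K * \<bar>y\<bar>" if "y \<ge> 0" for y
    proof (cases "y = 0")
      case False
      have "\<bar>flat_exp n y\<bar> / y \<le> ?K * y ^ 2 / y"
        by (rule divide_right_mono[OF abs_flat_exp_le'[OF that] that])
      also have "\<dots> = ?K * \<bar>y\<bar>" using that False by (simp only: power2_eq_square) simp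
      finally show ?thesis using that by (simp only: real_norm_def abs_divide abs_of_nonneg)
    qed simp
    then have "eventually (\<lambda>y. norm (flat_exp n y / y) \<le> ?K * \<bar>y\<bar>) (at 0 within {0..})"
      unfolding eventually_at_filter by (intro always_eventually allI impI) (simp only: atLeast_iff)
    ultimately have "((\<lambda>y. flat_exp n y / y) \<longlongrightarrow> 0) (at 0 within {0..})"
      by (rule Lim_null_comparison[rotated])
    moreover have "flat_exp m 0 = 0" for m by (simp add: flat_exp_def)
    ultimately show ?thesis using 1 by (simp add: has_field_derivative_iff)
  next
    case 2
    let ?g = "\<lambda>z::complex. exp (- inverse z)"
    have "(deriv ^^ n) ?g holomorphic_on - {0}"
      by (intro holomorphic_higher_deriv holomorphic_intros) auto
    from holomorphic_derivI[OF this open_Compl[OF closed_singleton], of "of_real t" UNIV]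
    have "((deriv ^^ n) ?g has_field_derivative (deriv ^^ Suc n) ?g (of_real t)) (at (of_real t))"
      using 2 by (simp only: funpow.simps o_apply) simp
    then have "((\<lambda>t. (deriv ^^ n) ?g (of_real t)) has_vector_derivative (deriv ^^ Suc n) ?g (of_real t)) (at t)"
      by (rule has_vector_derivative_real_field)
    then have "((\<lambda>t. Re ((deriv ^^ n) ?g (of_real t))) has_real_derivative Re ((deriv ^^ Suc n) ?g (of_real t))) (at t)"
      unfolding has_real_derivative_iff_has_vector_derivative
      by (rule bounded_linear.has_vector_derivative[OF bounded_linear_Re])
    then have "(flat_exp n has_real_derivative Re ((deriv ^^ Suc n) ?g (of_real t))) (at t)"
      by (rule has_field_derivative_transform_within[where d = t])
         (use 2 in \<open>simp_all add: flat_exp_def dist_real_def\<close>)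
    moreover have "Re ((deriv ^^ Suc n) ?g (of_real t)) = flat_exp (Suc n) t"
      using 2 by (simp only: flat_exp_def if_True)
    ultimately show ?thesis by (simp only: has_field_derivative_at_within)
  qed
qed

lemma jets_reflect:
  assumes "jets f {0..}"
  shows "jets (\<lambda>n t. (- 1) ^ n * f n (T - t)) {..T}"
proof (rule jetsI)
  fix n t assume t: "t \<in> {..T}"
  have "(f n has_real_derivative f (Suc n) (T - t)) (at (T - t) within (\<lambda>t. T - t) ` {..T})"
    by (rule has_field_derivative_subset[OF jetsD[OF assms]]) (use t in auto)
  moreover have "((\<lambda>t. T - t) has_real_derivative - 1) (at t within {..T})"
    by (auto intro!: derivative_eq_intros)
  ultimately have "(f n \<circ> (\<lambda>t. T - t) has_real_derivative f (Suc n) (T - t) * (- 1)) (at t within {..T})"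
    by (rule DERIV_image_chain)
  then have "((\<lambda>t. f n (T - t)) has_real_derivative f (Suc n) (T - t) * (- 1)) (at t within {..T})"
    by (simp add: o_def)
  from DERIV_cmult[OF this, of "(- 1) ^ n"]
  show "((\<lambda>t. (- 1) ^ n * f n (T - t)) has_real_derivative (- 1) ^ Suc n * f (Suc n) (T - t)) (at t within {..T})"
    by simp
qed

text \<open>\<open>\<psi>\<close> is the normalized primitive of a bump \<open>g\<close> that is
  flat at both ends. The product defining \<open>g\<close> keeps order 2 because
  \<open>k! (m - k)!\<close> divides \<open>m!\<close>.\<close>

lemma smooth_cutoff:
  fixes T :: real
  assumes T: "T > 0"
  obtains \<psi> C where "jets \<psi> {0..T}" "\<And>n. \<psi> n 0 = 0" "\<psi> 0 T = 1" "\<And>n. n > 0 \<Longrightarrow> \<psi> n T = 0"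
    "\<And>n t. t \<in> {0..T} \<Longrightarrow> \<bar>\<psi> n t\<bar> \<le> C * 9 ^ n * (fact n)\<^sup>2"
proof -
  define g where "g n t = (\<Sum>k\<le>n. real (n choose k) * flat_exp k t * ((- 1) ^ (n - k) * flat_exp (n - k) (T - t)))" for n t
  define I where "I = integral {0..T} (g 0)"
  \<comment> \<open>The primitive shifts the tower by one: the derivative of order
    \<open>Suc m\<close> is the \<open>m\<close>-th derivative of the bump divided by
    \<open>I\<close>.\<close>
  define \<psi> where "\<psi> n t = (case n of 0 \<Rightarrow> integral {0..t} (g 0) / I | Suc m \<Rightarrow> g m t / I)" for n t
  have g: "jets g {0..T}"
    unfolding g_def using jets_flat_exp jets_reflect[OF jets_flat_exp, of T]
    by (intro jets_mult) (auto intro: jets_subset)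
  have flat0: "flat_exp m 0 = 0" for m by (simp add: flat_exp_def)
  have g0: "g n 0 = 0" "g n T = 0" for n by (simp_all add: g_def flat0)
  have cg: "continuous_on {0..T} (g 0)" by (rule jets_continuous_on[OF g])
  have g_eq: "g 0 t = flat_exp 0 t * flat_exp 0 (T - t)" for t by (simp add: g_def)
  have pos: "flat_exp 0 t > 0" if "t > 0" for t
  proof -
    have "exp (- inverse (complex_of_real t)) = of_real (exp (- inverse t))"
      by (simp flip: exp_of_real)
    then show ?thesis using that by (simp add: flat_exp_def)
  qed
  then have nn: "flat_exp 0 t \<ge> 0" for t by (cases "t > 0") (auto simp: flat_exp_def intro: less_imp_le)
  have "I \<noteq> 0"
  proof
    assume "I = 0"
    then have "\<forall>t\<in>{0..T}. g 0 t = 0"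
      using integral_eq_0_iff[OF cg] T nn by (auto simp: I_def g_eq)
    then have "g 0 (T/2) = 0" using T by simp
    moreover have "g 0 (T/2) > 0" using T pos by (simp add: g_eq)
    ultimately show False by simp
  qed
  moreover have "I \<ge> 0"
    unfolding I_def by (rule integral_nonneg[OF integrable_continuous_real[OF cg]]) (simp add: g_eq nn)
  ultimately have I: "I > 0" by simp
  show thesis
  proof (rule that[of \<psi>])
    show j: "jets \<psi> {0..T}"
    proof (rule jetsI)
      fix n t assume t: "t \<in> {0..T}"
      show "(\<psi> n has_real_derivative \<psi> (Suc n) t) (at t within {0..T})"
      proof (cases n)
        case 0
        then show ?thesis
          using integral_has_real_derivative[OF cg t] unfolding \<psi>_def by (auto intro: DERIV_cdivide)
      next
        case (Suc m)
        then show ?thesis using jetsD[OF g t, of m] unfolding \<psi>_def by (auto intro: DERIV_cdivide)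
      qed
    qed
    show "\<psi> n 0 = 0" for n by (simp add: \<psi>_def g0 split: nat.split)
    show "\<psi> 0 T = 1" using I by (simp add: \<psi>_def I_def)
    show "\<psi> n T = 0" if "n > 0" for n using that by (cases n) (simp_all add: \<psi>_def g0)
    fix n t assume t: "t \<in> {0..T}"
    show "\<bar>\<psi> n t\<bar> \<le> (1 + 1 / I) * 9 ^ n * (fact n)\<^sup>2"
    proof (cases n)
      case 0
      have ig: "g 0 integrable_on {0..T}" by (rule integrable_continuous_real[OF cg])
      have "integral {0..t} (g 0) \<le> I" unfolding I_def
        using t nn by (intro integral_subset_le integrable_on_subinterval[OF ig] ig) (auto simp: g_eq)
      moreover have "integral {0..t} (g 0) \<ge> 0"
        using t nn by (intro integral_nonneg integrable_on_subinterval[OF ig]) (auto simp: g_eq)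
      ultimately have "\<bar>\<psi> 0 t\<bar> \<le> 1" using I by (simp add: \<psi>_def)
      also have "\<dots> \<le> 1 + 1 / I" using I by simp
      finally show ?thesis using 0 by simp
    next
      case (Suc m)
      have "\<bar>g m t\<bar> \<le> (\<Sum>k\<le>m. 9 ^ m * (fact m)\<^sup>2)"
        unfolding g_def
      proof (rule order_trans[OF sum_abs sum_mono])
        fix k assume k: "k \<in> {..m}"
        have "\<bar>real (m choose k) * flat_exp k t * ((- 1) ^ (m - k) * flat_exp (m - k) (T - t))\<bar>
            = real (m choose k) * (\<bar>flat_exp k t\<bar> * \<bar>flat_exp (m - k) (T - t)\<bar>)"
          by (simp add: abs_mult power_abs)
        also have "\<dots> \<le> real (m choose k) * ((9 ^ k * (fact k)\<^sup>2) * (9 ^ (m - k) * (fact (m - k))\<^sup>2))"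
          using t by (intro mult_left_mono mult_mono abs_flat_exp_le_gevrey) auto
        also have "\<dots> = real (fact k * fact (m - k) * (m choose k)) * (fact k * fact (m - k)) * (9 ^ k * 9 ^ (m - k))"
          by (simp add: power2_eq_square)
        also have "\<dots> = fact m * (fact k * fact (m - k)) * 9 ^ m"
          using k by (simp only: binomial_fact_lemma atMost_iff of_nat_fact power_add[symmetric] le_add_diff_inverse)
        also have "\<dots> \<le> fact m * fact m * 9 ^ m"
        proof -
          have "fact k * fact (m - k) dvd (fact m :: nat)" using k by (metis atMost_iff binomial_fact_lemma dvd_triv_left)
          then have "fact k * fact (m - k) \<le> (fact m :: nat)" by (rule dvd_imp_le) simp
          then have "real (fact k * fact (m - k)) \<le> real (fact m)" by (rule of_nat_mono)
          then show ?thesis by (intro mult_right_mono mult_left_mono) auto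
        qed
        finally show "\<bar>real (m choose k) * flat_exp k t * ((- 1) ^ (m - k) * flat_exp (m - k) (T - t))\<bar>
           \<le> 9 ^ m * (fact m)\<^sup>2" by (simp add: power2_eq_square mult.commute)
      qed
      also have "\<dots> = 9 ^ m * ((real m + 1) * (fact m)\<^sup>2)" by simp
      \<comment> \<open>With \<open>n = Suc m\<close>, the number \<open>m + 1\<close> of summands
        is absorbed by \<open>(fact n)^2 = (m + 1)^2 * (fact m)^2\<close>.\<close>
      also have "\<dots> \<le> 9 ^ n * (fact n)\<^sup>2"
      proof (rule mult_mono)
        have "(real m + 1) * (fact m)\<^sup>2 \<le> (real m + 1)\<^sup>2 * (fact m)\<^sup>2"
          by (intro mult_right_mono) (auto simp: power2_eq_square)
        also have "\<dots> = (fact n)\<^sup>2" using Suc by (simp add: power_mult_distrib add.commute)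
        finally show "(real m + 1) * (fact m)\<^sup>2 \<le> (fact n)\<^sup>2" .
      qed (use Suc in auto)
      finally have "\<bar>g m t\<bar> \<le> 9 ^ n * (fact n)\<^sup>2" .
      then have "\<bar>\<psi> n t\<bar> \<le> 1 / I * (9 ^ n * (fact n)\<^sup>2)"
        using I Suc by (simp add: \<psi>_def abs_divide divide_right_mono)
      also have "\<dots> \<le> (1 + 1 / I) * (9 ^ n * (fact n)\<^sup>2)" by (intro mult_right_mono) auto
      finally show ?thesis by (simp only: mult.assoc)
    qed
  qed
qed

text \<open>Divided by \<open>j! k!\<close> it reads
  \<open>(n choose k) * k!^2 * (5j)! <= (5n)! / k!\<close> for \<open>n = j + k\<close>: an order-2
  cutoff not only fits into order 5 but leaves a summable \<open>1 / k!\<close>. Raising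
  \<open>k\<close> by one adds three factors on the left and five larger ones on the right.\<close>

lemma fact_add_mult_le: "fact (j + k) * (fact k)\<^sup>2 * fact (5 * j) \<le> (fact (5 * (j + k)) * fact j :: real)"
proof (induction k)
  have fact5: "fact (N + 5) = real (N + 5) * (real (N + 4) * (real (N + 3) * (real (N + 2) * (real (N + 1) * fact N))))" for N
    by (simp add: numeral_eq_Suc)
  case (Suc k)
  let ?N = "5 * (j + k)"
  have "fact (j + Suc k) * (fact (Suc k))\<^sup>2 * fact (5 * j)
      = real (j + k + 1) * (real (k + 1) * real (k + 1)) * (fact (j + k) * (fact k)\<^sup>2 * fact (5 * j))"
    by (simp add: power2_eq_square)
  also have "\<dots> \<le> real (?N + 1) * (real (?N + 2) * real (?N + 3)) * (fact ?N * fact j)"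
    by (intro mult_mono Suc) auto
  also have "\<dots> \<le> (real (?N + 5) * real (?N + 4)) * (real (?N + 1) * (real (?N + 2) * real (?N + 3)) * (fact ?N * fact j))"
  proof -
    have "1 * 1 \<le> real (?N + 5) * real (?N + 4)" by (intro mult_mono) auto
    then have "1 * (real (?N + 1) * (real (?N + 2) * real (?N + 3)) * (fact ?N * fact j))
      \<le> (real (?N + 5) * real (?N + 4)) * (real (?N + 1) * (real (?N + 2) * real (?N + 3)) * (fact ?N * fact j))"
      by (intro mult_right_mono) auto
    then show ?thesis by simp
  qed
  also have "\<dots> = (real (?N + 5) * (real (?N + 4) * (real (?N + 3) * (real (?N + 2) * (real (?N + 1) * fact ?N))))) * fact j"
    by (simp only: ac_simps)
  also have "\<dots> = fact (?N + 5) * fact j"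
    by (simp only: fact5)
  also have "?N + 5 = 5 * (j + Suc k)" by simp
  finally show ?case .
qed simp

text \<open>In Leibniz' formula for cutoff times transform, the \<open>k\<close>-th term carries
  \<open>(9 * (5/4)^5)^k / k!\<close>. The sum is thus bounded by an exponential independent of
  \<open>n\<close>, and the constant 5/4 is preserved.\<close>

lemma borel_interval:
  fixes T :: real
  assumes T: "T > 0" and d: "\<And>n. \<bar>d n\<bar> \<le> C * fact (5 * n) / 3 ^ (5 * n)"
  obtains f M where "jets f {0..T}" "\<And>n. f n T = d n" "\<And>n. f n 0 = 0"
    "\<And>n t. t \<in> {0..T} \<Longrightarrow> \<bar>f n t\<bar> \<le> M * (fact (5 * n) / (5/4) ^ (5 * n))"
proof -
  obtain F M where F: "jets F {0..}" "\<And>n. F n 0 = (- 1) ^ n * d n"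
    and F_le: "\<And>n \<tau>. \<tau> \<ge> 0 \<Longrightarrow> \<bar>F n \<tau>\<bar> \<le> M * (fact (5 * n) / (5/4) ^ (5 * n))"
    by (rule borel_half_line[OF d]) (rule that)
  obtain \<psi> L where \<psi>: "jets \<psi> {0..T}" "\<And>n. \<psi> n 0 = 0" "\<psi> 0 T = 1" "\<And>n. n > 0 \<Longrightarrow> \<psi> n T = 0"
    and \<psi>_le: "\<And>n t. t \<in> {0..T} \<Longrightarrow> \<bar>\<psi> n t\<bar> \<le> L * 9 ^ n * (fact n)\<^sup>2"
    by (rule smooth_cutoff[OF T]) (rule that)
  have M0: "M \<ge> 0" using F_le[of 0 0] by simp
  have L0: "L \<ge> 0" using \<psi>_le[of 0 0] T by simp
  define G where "G n t = (- 1) ^ n * F n (T - t)" for n t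
  define f where "f n t = (\<Sum>k\<le>n. real (n choose k) * \<psi> k t * G (n - k) t)" for n t
  let ?b = "(5/4)::real"
  show thesis
  proof (rule that[of f])
    show "jets f {0..T}"
      unfolding f_def G_def using \<psi>(1) jets_reflect[OF F(1), of T]
      by (intro jets_mult) (auto intro: jets_subset)
    show "f n 0 = 0" for n by (simp add: f_def \<psi>)
    show "f n T = d n" for n
    proof -
      \<comment> \<open>At \<open>T\<close> all derivatives of the cutoff vanish and its value is 1,
        so only the term \<open>k = 0\<close> survives.\<close>
      have "f n T = (\<Sum>k\<le>n. if k = 0 then G n T else 0)"
        unfolding f_def by (intro sum.cong) (auto simp: \<psi>)
      also have "\<dots> = d n" by (simp add: G_def F flip: mult.assoc power_mult_distrib)
      finally show ?thesis .
    qed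
    fix n t assume t: "t \<in> {0..T}"
    have "\<bar>f n t\<bar> \<le> (\<Sum>k\<le>n. L * M * (fact (5 * n) / ?b ^ (5 * n)) * ((9 * ?b ^ 5) ^ k /\<^sub>R fact k))"
      unfolding f_def
    proof (rule order_trans[OF sum_abs sum_mono])
      fix k assume "k \<in> {..n}"
      then obtain j where n: "n = j + k" by (metis atMost_iff le_add_diff_inverse2)
      have "\<bar>real (n choose k) * \<psi> k t * G (n - k) t\<bar> = real (n choose k) * (\<bar>\<psi> k t\<bar> * \<bar>F j (T - t)\<bar>)"
        by (simp add: G_def abs_mult power_abs n)
      also have "\<dots> \<le> real (n choose k) * ((L * 9 ^ k * (fact k)\<^sup>2) * (M * (fact (5 * j) / ?b ^ (5 * j))))"
        using t L0 by (intro mult_left_mono mult_mono \<psi>_le F_le) auto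
      also have "\<dots>
          = L * M * 9 ^ k / (fact k * fact j * ?b ^ (5 * j)) * (fact (j + k) * (fact k)\<^sup>2 * fact (5 * j))"
        by (simp add: binomial_fact n)
      also have "\<dots> \<le> L * M * 9 ^ k / (fact k * fact j * ?b ^ (5 * j)) * (fact (5 * (j + k)) * fact j)"
        using L0 M0 by (intro mult_left_mono fact_add_mult_le) auto
      also have "\<dots> = L * M * (fact (5 * n) / ?b ^ (5 * n)) * ((9 * ?b ^ 5) ^ k /\<^sub>R fact k)"
      proof -
        have "?b ^ (5 * n) = ?b ^ (5 * j) * (?b ^ 5) ^ k"
          by (simp add: n power_add power_mult distrib_left)
        then show ?thesis unfolding n
          by (simp only: power_mult_distrib) (simp add: field_simps del: power_divide)
      qed
      finally show "\<bar>real (n choose k) * \<psi> k t * G (n - k) t\<bar>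
          \<le> L * M * (fact (5 * n) / ?b ^ (5 * n)) * ((9 * ?b ^ 5) ^ k /\<^sub>R fact k)" .
    qed
    also have "\<dots> = L * M * (fact (5 * n) / ?b ^ (5 * n)) * (\<Sum>k\<le>n. (9 * ?b ^ 5) ^ k /\<^sub>R fact k)"
      by (simp only: sum_distrib_left)
    also have "\<dots> \<le> L * M * (fact (5 * n) / ?b ^ (5 * n)) * exp (9 * ?b ^ 5)"
      unfolding exp_def using L0 M0
      by (intro mult_left_mono sum_le_suminf summable_exp_generic) auto
    finally show "\<bar>f n t\<bar> \<le> (L * M * exp (9 * ?b ^ 5)) * (fact (5 * n) / ?b ^ (5 * n))"
      by (simp only: ac_simps)
  qed
qed

section \<open>Power series solutions\<close>

text \<open>\<open>coef y z k m\<close> is the \<open>m\<close>-th time derivative of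
  \<open>a_k\<close>; the index \<open>m\<close> is carried because the recursion for
  \<open>a_k\<close> differentiates in time.\<close>

fun coef :: "(nat \<Rightarrow> real \<Rightarrow> real) \<Rightarrow> (nat \<Rightarrow> real \<Rightarrow> real) \<Rightarrow> nat \<Rightarrow> nat \<Rightarrow> real \<Rightarrow> real" where
  "coef y z 0 m = (\<lambda>t. 0)"
| "coef y z (Suc 0) m = (\<lambda>t. 0)"
| "coef y z (Suc (Suc 0)) m = (\<lambda>t. 0)"
| "coef y z (Suc (Suc (Suc 0))) m = y m"
| "coef y z (Suc (Suc (Suc (Suc 0)))) m = z m"
| "coef y z (Suc (Suc (Suc (Suc (Suc k))))) m =
    (\<lambda>t. coef y z k (Suc m) t + coef y z (Suc k) m t + coef y z (Suc (Suc (Suc k))) m t)"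

lemma coef_add_5: "coef y z (k + 5) m t = coef y z k (Suc m) t + coef y z (k + 1) m t + coef y z (k + 3) m t"
  by (simp add: numeral_eq_Suc)

lemma jets_coef:
  assumes "jets y S" "jets z S"
  shows "jets (coef y z k) S"
proof (rule jetsI)
  show "(coef y z k m has_real_derivative coef y z k (Suc m) x) (at x within S)" if "x \<in> S" for m x
    using assms
    by (induction y z k m rule: coef.induct) (auto intro: DERIV_add jetsD that)
qed

text \<open>It compares the lower-order terms of the equation with the fifth-order one; 120 =
  5*4*3*2 and 20 = 5*4 are the quotients of factorials at \<open>n = 0\<close>, the worst
  case.\<close>

lemma fact_div_power_le:
  assumes "b > (0::real)"
  shows "fact (n + 1) / b ^ (n + 1) \<le> b ^ 4 / 120 * (fact (n + 5) / b ^ (n + 5))"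
    and "fact (n + 3) / b ^ (n + 3) \<le> b ^ 2 / 20 * (fact (n + 5) / b ^ (n + 5))"
proof -
  have "fact (n + 5) = real (n + 5) * (real (n + 4) * (real (n + 3) * (real (n + 2) * fact (n + 1))))"
    by (simp add: numeral_eq_Suc)
  moreover have "5 * (4 * (3 * (2 * fact (n + 1)))) \<le> real (n + 5) * (real (n + 4) * (real (n + 3) * (real (n + 2) * fact (n + 1))))"
    by (intro mult_mono) auto
  ultimately have "fact (n + 1) \<le> fact (n + 5) / (120::real)" by linarith
  then have "fact (n + 1) / b ^ (n + 1) \<le> (fact (n + 5) / 120) / b ^ (n + 1)"
    using assms by (intro divide_right_mono) auto
  also have "\<dots> = b ^ 4 / 120 * (fact (n + 5) / b ^ (n + 5))"
  proof -
    have "b ^ (n + 5) = b ^ 4 * b ^ (n + 1)" by (subst power_add[symmetric]) (simp add: add.commute)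
    then show ?thesis using assms by simp
  qed
  finally show "fact (n + 1) / b ^ (n + 1) \<le> b ^ 4 / 120 * (fact (n + 5) / b ^ (n + 5))" .
  have "fact (n + 5) = real (n + 5) * (real (n + 4) * fact (n + 3))"
    by (simp add: numeral_eq_Suc)
  moreover have "5 * (4 * fact (n + 3)) \<le> real (n + 5) * (real (n + 4) * fact (n + 3))"
    by (intro mult_mono) auto
  ultimately have "fact (n + 3) \<le> fact (n + 5) / (20::real)" by linarith
  then have "fact (n + 3) / b ^ (n + 3) \<le> (fact (n + 5) / 20) / b ^ (n + 3)"
    using assms by (intro divide_right_mono) auto
  also have "\<dots> = b ^ 2 / 20 * (fact (n + 5) / b ^ (n + 5))"
  proof -
    have "b ^ (n + 5) = b ^ 2 * b ^ (n + 3)" by (subst power_add[symmetric]) (simp add: add.commute)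
    then show ?thesis using assms by simp
  qed
  finally show "fact (n + 3) / b ^ (n + 3) \<le> b ^ 2 / 20 * (fact (n + 5) / b ^ (n + 5))" .
qed

text \<open>The induction closes because \<open>(11/10)\<^sup>5\<close> exceeds
  \<open>1 + (11/10) (5/4)\<^sup>4 / 120 + (11/10)\<^sup>3 (5/4)\<^sup>2 / 20\<close>, while \<open>11/10 < 5/4\<close> keeps the radius of
  convergence of the power series in \<open>x\<close> above 1.\<close>

lemma abs_coef_le:
  fixes M :: real
  assumes y: "\<And>m. \<bar>y m t\<bar> \<le> M * (fact (5 * m) / (5/4) ^ (5 * m))"
    and z: "\<And>m. \<bar>z m t\<bar> \<le> M * (fact (5 * m) / (5/4) ^ (5 * m))"
  defines "w \<equiv> \<lambda>N. fact N / (5/4) ^ N"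
  shows "\<bar>coef y z k m t\<bar> \<le> (M * (5/4) ^ 4) * (11/10) ^ k * w (k + 5 * m)"
  using y z
proof (induction y z k m rule: coef.induct)
  have M: "M \<ge> 0" if "\<And>m. \<bar>y m t\<bar> \<le> M * (fact (5 * m) / (5/4) ^ (5 * m))" for y :: "nat \<Rightarrow> real \<Rightarrow> real"
    using that[of 0] by simp
  have w0: "w N \<ge> 0" for N by (simp add: w_def)
  \<comment> \<open>Enlarging \<open>(5m)!\<close> to \<open>(k + 5m)!\<close> while normalizing by
    the matching power of 5/4 costs \<open>(5/4)^k\<close>, at most \<open>(5/4)^4\<close> for
    \<open>k <= 4\<close>.\<close>
  have start: "\<bar>y m t\<bar> \<le> (M * (5/4) ^ 4) * (11/10) ^ k * w (k + 5 * m)"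
    if y: "\<And>m. \<bar>y m t\<bar> \<le> M * (fact (5 * m) / (5/4) ^ (5 * m))" and k: "k \<le> 4"
    for k m and y :: "nat \<Rightarrow> real \<Rightarrow> real"
  proof -
    note y
    also have "M * (fact (5 * m) / (5/4) ^ (5 * m)) \<le> M * (fact (k + 5 * m) / (5/4) ^ (5 * m))"
      using M[of y, OF y] by (intro mult_left_mono divide_right_mono fact_mono) auto
    also have "\<dots> = M * (5/4) ^ k * w (k + 5 * m)" by (simp add: w_def power_add)
    also have "\<dots> \<le> M * (5/4) ^ 4 * w (k + 5 * m)"
      using k M[of y, OF y] w0 by (intro mult_right_mono mult_left_mono power_increasing) auto
    also have "\<dots> \<le> (M * (5/4) ^ 4) * (11/10) ^ k * w (k + 5 * m)"
    proof (rule mult_right_mono[OF _ w0])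
      have "(M * (5/4) ^ 4) * 1 \<le> (M * (5/4) ^ 4) * (11/10) ^ k"
        using M[of y, OF y] by (intro mult_left_mono one_le_power) auto
      then show "M * (5/4) ^ 4 \<le> (M * (5/4) ^ 4) * (11/10) ^ k" by simp
    qed
    finally show ?thesis .
  qed
  note M0 = mult_nonneg_nonneg[OF _ w0]
  {
    case (1 y z m) then show ?case using M[of y] M0 by simp
  next
    case (2 y z m) then show ?case using M[of y] M0 by simp
  next
    case (3 y z m) then show ?case using M[of y] M0 by simp
  next
    case (4 y z m) then show ?case using start[of y 3 m] by (simp add: numeral_eq_Suc)
  next
    case (5 y z m) then show ?case using start[of z 4 m] by (simp add: numeral_eq_Suc)
  next
    case (6 y z k m)
    define N where "N = k + 5 * m"
    define C where "C = M * (5/4) ^ 4 * (11/10) ^ k"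
    have C: "C \<ge> 0" using M[of y] 6(4) by (simp add: C_def)
    have "\<bar>coef y z (Suc (Suc (Suc (Suc (Suc k))))) m t\<bar>
        \<le> \<bar>coef y z k (Suc m) t\<bar> + \<bar>coef y z (Suc k) m t\<bar> + \<bar>coef y z (Suc (Suc (Suc k))) m t\<bar>"
      by simp
    \<comment> \<open>One time derivative weighs as much as five space indices, so the three terms
      have weights \<open>N + 5\<close>, \<open>N + 1\<close> and \<open>N + 3\<close>.\<close>
    also have "\<dots> \<le> C * w (N + 5) + C * (11/10) * w (N + 1) + C * (11/10) ^ 3 * w (N + 3)"
      using 6(1-3)[OF 6(4,5)] unfolding C_def N_def
      by (intro add_mono) (simp_all add: numeral_eq_Suc ac_simps)
    also have "\<dots> \<le> C * w (N + 5) + C * (11/10) * ((5/4) ^ 4 / 120 * w (N + 5))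
        + C * (11/10) ^ 3 * ((5/4) ^ 2 / 20 * w (N + 5))"
      unfolding w_def using C by (intro add_mono mult_left_mono fact_div_power_le) auto
    also have "\<dots> = C * w (N + 5) * (1 + (11/10) * ((5/4) ^ 4 / 120) + (11/10) ^ 3 * ((5/4) ^ 2 / 20))"
      by (simp add: algebra_simps)
    also have "\<dots> \<le> C * w (N + 5) * (11/10) ^ 5"
      using C w0 by (intro mult_left_mono) (auto simp: eval_nat_numeral)
    also have "\<dots> = (M * (5/4) ^ 4) * (11/10) ^ Suc (Suc (Suc (Suc (Suc k)))) * w (Suc (Suc (Suc (Suc (Suc k)))) + 5 * m)"
      by (simp add: C_def N_def numeral_eq_Suc ac_simps)
    finally show ?case .
  }
qed

lemma choose_mult_power_le:
  assumes "e \<ge> (0::real)" shows "real ((k + p) choose p) * e ^ p \<le> (1 + e) ^ (k + p)"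
proof -
  have "real ((k + p) choose p) * e ^ p = (\<Sum>i\<in>{p}. real ((k + p) choose i) * e ^ i)" by simp
  also have "\<dots> \<le> (\<Sum>i\<le>k + p. real ((k + p) choose i) * e ^ i)"
    using assms by (intro sum_mono2) auto
  also have "\<dots> = (1 + e) ^ (k + p)"
    using binomial_ring[of e 1 "k + p"] by (simp add: add.commute)
  finally show ?thesis .
qed

text \<open>The growth 11/10 of \<open>abs_coef_le\<close> over 5/4 gives 22/25. Splitting
  \<open>fact (k + p)\<close> leaves a binomial coefficient, which by
  \<open>choose_mult_power_le\<close> with \<open>e = 1/10\<close> costs another 11/10 per
  \<open>k\<close>; the product 121/125 is still below 1.\<close>

lemma abs_coef_div_fact_le:
  assumes y: "\<And>m. \<bar>y m t\<bar> \<le> M * (fact (5 * m) / (5/4) ^ (5 * m))"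
    and z: "\<And>m. \<bar>z m t\<bar> \<le> M * (fact (5 * m) / (5/4) ^ (5 * m))"
  shows "\<bar>coef y z (k + n) m t / fact k\<bar> \<le> (M * (5/4) ^ 4) * 11 ^ (n + 5 * m) * fact (n + 5 * m) * (121/125) ^ k"
proof -
  define p where "p = n + 5 * m"
  have M: "M \<ge> 0" using y[of 0] by simp
  have "\<bar>coef y z (k + n) m t\<bar> \<le> (M * (5/4) ^ 4) * (11/10) ^ (k + n) * (fact (k + p) / (5/4) ^ (k + p))"
    using abs_coef_le[of y t M z, OF y z, of "k + n" m] by (simp add: p_def add.assoc)
  also have "\<dots> = (M * (5/4) ^ 4) * fact (k + p) * (11/10) ^ (k + n) / (5/4) ^ (k + p)"
    by simp
  also have "\<dots> \<le> (M * (5/4) ^ 4) * fact (k + p) * (11/10) ^ (k + n) / (5/4) ^ (k + n)"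
    using M by (intro divide_left_mono mult_pos_pos power_increasing) (auto simp: p_def)
  also have "\<dots> = (M * (5/4) ^ 4) * fact (k + p) * ((22/25) ^ k * (22/25) ^ n)"
  proof -
    have "(11/10) ^ (k + n) / (5/4) ^ (k + n) = (22/25 :: real) ^ (k + n)" by (simp flip: power_divide)
    then show ?thesis by (simp only: times_divide_eq_right[symmetric] power_add)
  qed
  also have "\<dots> \<le> (M * (5/4) ^ 4) * fact (k + p) * ((22/25) ^ k * 1)"
    using M by (intro mult_left_mono) (auto intro!: power_le_one)
  also have "fact (k + p) = fact k * fact p * real ((k + p) choose p)"
    by (simp add: binomial_fact)
  finally have "\<bar>coef y z (k + n) m t\<bar> / fact k \<le> (M * (5/4) ^ 4) * fact p * (real ((k + p) choose p) * (22/25) ^ k)"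
    by (simp add: field_simps)
  also have "\<dots> \<le> (M * (5/4) ^ 4) * fact p * (11 ^ p * (121/125) ^ k)"
  proof (rule mult_left_mono)
    have "real ((k + p) choose p) \<le> (11/10) ^ (k + p) / (1/10) ^ p"
      using choose_mult_power_le[of "1/10" k p] by (simp add: field_simps)
    also have "\<dots> = 11 ^ p * (11/10) ^ k"
    proof -
      have "(11/10) ^ p / (1/10) ^ p = (11 :: real) ^ p" by (simp flip: power_divide)
      then show ?thesis by (simp only: power_add times_divide_eq_right[symmetric] mult.commute)
    qed
    finally have "real ((k + p) choose p) * (22/25) ^ k \<le> 11 ^ p * (11/10) ^ k * (22/25) ^ k"
      by (rule mult_right_mono) simp
    also have "\<dots> = 11 ^ p * (121/125) ^ k"
      by (simp add: mult.assoc flip: power_mult_distrib)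
    finally show "real ((k + p) choose p) * (22/25) ^ k \<le> 11 ^ p * (121/125) ^ k" .
  qed (use M in simp)
  finally show ?thesis by (simp add: p_def ac_simps)
qed

section \<open>Towers of mixed partial derivatives\<close>

definition jets2 :: "(nat \<Rightarrow> nat \<Rightarrow> real \<Rightarrow> real \<Rightarrow> real) \<Rightarrow> real set \<Rightarrow> real set \<Rightarrow> bool" where
  "jets2 U A B \<longleftrightarrow> (\<forall>n m. continuous_on (A \<times> B) (\<lambda>(x, t). U n m x t) \<and>
     (\<forall>x\<in>A. \<forall>t\<in>B. ((\<lambda>x. U n m x t) has_real_derivative U (Suc n) m x t) (at x within A) \<and>
        (U n m x has_real_derivative U n (Suc m) x t) (at t within B)))"

context
  fixes U :: "nat \<Rightarrow> nat \<Rightarrow> real \<Rightarrow> real \<Rightarrow> real" and a b c d :: real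
  assumes ab: "a < b" and cd: "c < d" and U: "jets2 U {a..b} {c..d}"
begin

lemma Dx_on_jets2:
  assumes "x \<in> {a..b}" "t \<in> {c..d}" "\<And>x. x \<in> {a..b} \<Longrightarrow> u x t = U n m x t"
  shows "Dx_on a b u x t = U (Suc n) m x t" "(\<lambda>y. u y t) differentiable (at x within {a..b})"
proof -
  have d: "((\<lambda>x. U n m x t) has_real_derivative U (Suc n) m x t) (at x within {a..b})"
    using U assms(1,2) unfolding jets2_def by blast
  show "Dx_on a b u x t = U (Suc n) m x t"
    unfolding Dx_on_def by (rule D_on_eqI(1)[OF ab assms(1) d]) (rule assms(3))
  show "(\<lambda>y. u y t) differentiable (at x within {a..b})"
    by (rule D_on_eqI(2)[OF ab assms(1) d]) (rule assms(3))
qed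

lemma Dt_on_jets2:
  assumes "x \<in> {a..b}" "t \<in> {c..d}" "\<And>t. t \<in> {c..d} \<Longrightarrow> u x t = U n m x t"
  shows "Dt_on c d u x t = U n (Suc m) x t" "u x differentiable (at t within {c..d})"
proof -
  have d: "(U n m x has_real_derivative U n (Suc m) x t) (at t within {c..d})"
    using U assms(1,2) unfolding jets2_def by blast
  show "Dt_on c d u x t = U n (Suc m) x t"
    unfolding Dt_on_def by (rule D_on_eqI(1)[OF cd assms(2) d]) (rule assms(3))
  show "u x differentiable (at t within {c..d})"
    by (rule D_on_eqI(2)[OF cd assms(2) d]) (rule assms(3))
qed

lemma Dx_on_funpow_jets2:
  assumes "t \<in> {c..d}" "\<And>x. x \<in> {a..b} \<Longrightarrow> u x t = U n m x t" "x \<in> {a..b}"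
  shows "(Dx_on a b ^^ k) u x t = U (n + k) m x t"
  using assms(3)
proof (induction k arbitrary: x)
  case (Suc k)
  have "Dx_on a b ((Dx_on a b ^^ k) u) x t = U (Suc (n + k)) m x t"
    by (rule Dx_on_jets2(1)[OF Suc.prems assms(1)]) (rule Suc.IH)
  then show ?case by simp
qed (use assms in simp)

lemma Dt_on_funpow_jets2:
  assumes "x \<in> {a..b}" "\<And>t. t \<in> {c..d} \<Longrightarrow> u x t = U n m x t" "t \<in> {c..d}"
  shows "(Dt_on c d ^^ k) u x t = U n (m + k) x t"
  using assms(3)
proof (induction k arbitrary: t)
  case (Suc k)
  have "Dt_on c d ((Dt_on c d ^^ k) u) x t = U n (Suc (m + k)) x t"
    by (rule Dt_on_jets2(1)[OF assms(1) Suc.prems]) (rule Suc.IH)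
  then show ?case by simp
qed (use assms in simp)

lemma Ck_on_rectangle_jets2:
  assumes "\<And>x t. x \<in> {a..b} \<Longrightarrow> t \<in> {c..d} \<Longrightarrow> u x t = U n m x t"
  shows "Ck_on_rectangle k a b c d u"
  using assms
proof (induction k arbitrary: u n m)
  case 0
  have "continuous_on ({a..b} \<times> {c..d}) (\<lambda>(x, t). U n m x t)" using U by (simp add: jets2_def)
  then have "continuous_on ({a..b} \<times> {c..d}) (\<lambda>(x, t). u x t)"
    by (rule continuous_on_eq) (auto simp: 0)
  then show ?case by simp
next
  case (Suc k)
  have "continuous_on ({a..b} \<times> {c..d}) (\<lambda>(x, t). U n m x t)" using U by (simp add: jets2_def)
  then have "continuous_on ({a..b} \<times> {c..d}) (\<lambda>(x, t). u x t)"
    by (rule continuous_on_eq) (auto simp: Suc.prems)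
  moreover have "Ck_on_rectangle k a b c d (Dx_on a b u)"
    by (rule Suc.IH[of _ "Suc n" m]) (rule Dx_on_jets2, use Suc.prems in auto)
  moreover have "Ck_on_rectangle k a b c d (Dt_on c d u)"
    by (rule Suc.IH[of _ n "Suc m"]) (rule Dt_on_jets2, use Suc.prems in auto)
  ultimately show ?case
    using Dx_on_jets2(2)[where u = u] Dt_on_jets2(2)[where u = u] Suc.prems by simp
qed

lemma gevrey2_jets2I:
  assumes "C > 0" "R1 > 0" "R2 > 0"
    and bd: "\<And>n m x t. x \<in> {a..b} \<Longrightarrow> t \<in> {c..d} \<Longrightarrow>
      \<bar>U n m x t\<bar> \<le> C * (fact n powr s1 / R1 ^ n) * (fact m powr s2 / R2 ^ m)"
  shows "U 0 0 \<in> gevrey2 s1 s2 a b c d"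
  unfolding gevrey2_def mem_Collect_eq smooth_on_rectangle_def
proof (intro conjI allI)
  show "Ck_on_rectangle k a b c d (U 0 0)" for k by (rule Ck_on_rectangle_jets2) simp
  have "(Dx_on a b ^^ n) ((Dt_on c d ^^ m) (U 0 0)) x t = U n m x t"
    if "x \<in> {a..b}" "t \<in> {c..d}" for n m x t
    using Dx_on_funpow_jets2[of t _ 0 m x n] Dt_on_funpow_jets2[of _ "U 0 0" 0 0 t m] that by simp
  then show "\<exists>C>0. \<exists>R1>0. \<exists>R2>0. \<forall>n m. \<forall>x\<in>{a..b}. \<forall>t\<in>{c..d}.
        \<bar>(Dx_on a b ^^ n) ((Dt_on c d ^^ m) (U 0 0)) x t\<bar>
          \<le> C * (fact n powr s1 / R1 ^ n) * (fact m powr s2 / R2 ^ m)"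
    using assms(1-3) bd by (intro exI[of _ C] conjI exI[of _ R1] exI[of _ R2]) auto
qed

end

lemma fact_add_le: "fact (n + m) \<le> (2 ^ (n + m) * fact n * fact m :: real)"
proof -
  have "fact (n + m) = real ((n + m) choose n) * fact n * fact m"
    by (simp add: binomial_fact)
  also have "\<dots> \<le> real (2 ^ (n + m)) * fact n * fact m"
    by (intro mult_right_mono of_nat_mono binomial_le_pow2) auto
  finally show ?thesis by simp
qed

text \<open>Each of the five new factors is at most \<open>5 * (m + 1)\<close>. This turns
  \<open>(5m)!\<close> into Gevrey order 5 in time.\<close>

lemma fact_times_5_le: "fact (5 * m) \<le> (5 ^ (5 * m) * fact m ^ 5 :: real)"
proof (induction m)
  case (Suc m)
  have q5: "q * (q * (q * (q * (q * X)))) = q ^ 5 * X" for q X :: real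
    by (simp add: eval_nat_numeral)
  let ?N = "5 * m" and ?q = "5 * real (Suc m)"
  have "fact (5 * Suc m) = fact (?N + 5)" by (simp only: mult_Suc_right add.commute)
  also have "\<dots> = real (?N + 5) * (real (?N + 4) * (real (?N + 3) * (real (?N + 2) * (real (?N + 1) * fact ?N))))"
    by (simp add: numeral_eq_Suc)
  also have "\<dots> \<le> ?q * (?q * (?q * (?q * (?q * (5 ^ (5 * m) * fact m ^ 5)))))"
    by (intro mult_mono Suc) auto
  also have "\<dots> = ?q ^ 5 * (5 ^ (5 * m) * fact m ^ 5)"
    by (simp only: q5)
  also have "\<dots> = 5 ^ (5 * Suc m) * fact (Suc m) ^ 5"
  proof -
    have "5 ^ (5 * Suc m) = (5::real) ^ 5 * 5 ^ (5 * m)" by (simp only: mult_Suc_right power_add)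
    then show ?thesis by (simp only: fact_Suc power_mult_distrib ac_simps)
  qed
  finally show ?case .
qed simp

text \<open>Differentiating in \<open>x\<close> shifts the Taylor coefficients, differentiating in
  \<open>t\<close> raises the second index of \<open>coef\<close>, so one formula covers every mixed
  derivative.\<close>

definition series :: "(nat \<Rightarrow> real \<Rightarrow> real) \<Rightarrow> (nat \<Rightarrow> real \<Rightarrow> real) \<Rightarrow> nat \<Rightarrow> nat \<Rightarrow> real \<Rightarrow> real \<Rightarrow> real" where
  "series y z n m x t = (\<Sum>k. coef y z (k + n) m t / fact k * x ^ k)"

section \<open>The solution generated by two flat outputs\<close>

locale kawahara_series =
  fixes y z :: "nat \<Rightarrow> real \<Rightarrow> real" and T M :: real
  assumes T: "T > 0" and jy: "jets y {0..T}" and jz: "jets z {0..T}"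
    and y_le: "\<And>m t. t \<in> {0..T} \<Longrightarrow> \<bar>y m t\<bar> \<le> M * (fact (5 * m) / (5/4) ^ (5 * m))"
    and z_le: "\<And>m t. t \<in> {0..T} \<Longrightarrow> \<bar>z m t\<bar> \<le> M * (fact (5 * m) / (5/4) ^ (5 * m))"
begin

abbreviation U where "U \<equiv> series y z"

definition K :: "nat \<Rightarrow> nat \<Rightarrow> real" where
  "K n m = (M * (5/4) ^ 4) * 11 ^ (n + 5 * m) * fact (n + 5 * m)"

lemma M_nonneg: "M \<ge> 0"
  using y_le[of 0 0] T by simp

text \<open>Allowing \<open>x\<close> up to 101/100 puts -1 strictly inside the disc of convergence,
  as termwise differentiation there requires; the ratio is 121/125 * 101/100 = 12221/12500.\<close>

lemma term_le:
  assumes "t \<in> {0..T}" "\<bar>x\<bar> \<le> 101/100"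
  shows "\<bar>coef y z (k + n) m t / fact k * x ^ k\<bar> \<le> K n m * (12221/12500) ^ k"
proof -
  have K0: "K n m \<ge> 0" using M_nonneg by (simp add: K_def)
  have "\<bar>coef y z (k + n) m t / fact k * x ^ k\<bar> = \<bar>coef y z (k + n) m t / fact k\<bar> * \<bar>x\<bar> ^ k"
    by (simp only: abs_mult power_abs)
  also have "\<dots> \<le> (K n m * (121/125) ^ k) * (101/100) ^ k"
    using K0 abs_coef_div_fact_le[of y t M z, OF y_le z_le] assms unfolding K_def[symmetric]
    by (intro mult_mono power_mono) auto
  also have "\<dots> = K n m * (12221/12500) ^ k"
    by (simp add: mult.assoc flip: power_mult_distrib)
  finally show ?thesis .
qed

lemma summable_K: "summable (\<lambda>k. K n m * (12221/12500) ^ k)"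
  by (intro summable_mult summable_geometric) simp

lemma summable_term:
  assumes "t \<in> {0..T}" "\<bar>x\<bar> \<le> 101/100"
  shows "summable (\<lambda>k. coef y z (k + n) m t / fact k * x ^ k)"
  by (rule summable_comparison_test'[OF summable_K[of n m], of 0]) (use term_le[OF assms] in simp)

lemma abs_series_le:
  assumes t: "t \<in> {0..T}" and x: "x \<in> {-1..0}"
  shows "\<bar>U n m x t\<bar> \<le> K n m * (12500/279)"
proof -
  have x': "\<bar>x\<bar> \<le> 101/100" using x by auto
  have s: "summable (\<lambda>k. \<bar>coef y z (k + n) m t / fact k * x ^ k\<bar>)"
    by (rule summable_comparison_test'[OF summable_K[of n m], of 0]) (use term_le[OF t x'] in simp)
  have "\<bar>U n m x t\<bar> \<le> (\<Sum>k. \<bar>coef y z (k + n) m t / fact k * x ^ k\<bar>)"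
    unfolding series_def by (rule summable_rabs[OF s])
  also have "\<dots> \<le> (\<Sum>k. K n m * (12221/12500) ^ k)"
    by (rule suminf_le[OF term_le[OF t x'] s summable_K])
  also have "\<dots> = K n m * (12500/279)"
    by (subst suminf_mult) (auto simp: suminf_geometric)
  finally show ?thesis .
qed

lemma series_has_derivative_x:
  assumes t: "t \<in> {0..T}" and x: "x \<in> {-1..0}"
  shows "((\<lambda>x. U n m x t) has_real_derivative U (Suc n) m x t) (at x within S)"
proof -
  let ?c = "\<lambda>k. coef y z (k + n) m t / fact k"
  have "((\<lambda>x. \<Sum>k. ?c k * x ^ k) has_real_derivative (\<Sum>k. diffs ?c k * x ^ k)) (at x)"
    by (rule termdiffs_strong[where K = "101/100"]) (use summable_term[OF t, of "101/100"] x in auto)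
  \<comment> \<open>The factor \<open>k + 1\<close> from differentiation cancels against the
    factorial, leaving the series with \<open>n\<close> raised by one.\<close>
  moreover have "diffs ?c k = coef y z (k + Suc n) m t / fact k" for k
    by (simp add: diffs_def del: of_nat_Suc)
  ultimately show ?thesis
    unfolding series_def by (simp add: has_field_derivative_at_within)
qed

lemma series_has_derivative_t:
  assumes t: "t \<in> {0..T}" and x: "x \<in> {-1..0}"
  shows "(U n m x has_real_derivative U n (Suc m) x t) (at t within {0..T})"
proof -
  have x': "\<bar>x\<bar> \<le> 101/100" using x by auto
  have "\<exists>g. \<forall>t\<in>{0..T}. (\<lambda>k. coef y z (k + n) m t / fact k * x ^ k) sums g t \<and>
      (g has_real_derivative U n (Suc m) x t) (at t within {0..T})"
  proof (rule has_field_derivative_series[where ?x0.0 = t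
      and f' = "\<lambda>k t. coef y z (k + n) (Suc m) t / fact k * x ^ k"])
    fix k t assume "t \<in> {0..T}"
    then have "((\<lambda>t. coef y z (k + n) m t * (x ^ k / fact k)) has_real_derivative
        coef y z (k + n) (Suc m) t * (x ^ k / fact k)) (at t within {0..T})"
      by (intro DERIV_cmult_right jetsD[OF jets_coef[OF jy jz]])
    then show "((\<lambda>t. coef y z (k + n) m t / fact k * x ^ k) has_real_derivative
        coef y z (k + n) (Suc m) t / fact k * x ^ k) (at t within {0..T})"
      by simp
  next
    show "uniform_limit {0..T} (\<lambda>N t. \<Sum>k<N. coef y z (k + n) (Suc m) t / fact k * x ^ k)
        (U n (Suc m) x) sequentially"
      unfolding series_def
      by (rule Weierstrass_m_test[OF _ summable_K[of n "Suc m"]]) (use term_le[OF _ x'] in simp)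
  qed (use t summable_term[OF t x'] in auto)
  then obtain g where g: "\<And>t. t \<in> {0..T} \<Longrightarrow> (\<lambda>k. coef y z (k + n) m t / fact k * x ^ k) sums g t"
      "(g has_real_derivative U n (Suc m) x t) (at t within {0..T})"
    using t by blast
  have "U n m x t = g t" if "t \<in> {0..T}" for t
    unfolding series_def using g(1)[OF that] by (rule sums_unique[symmetric])
  then show ?thesis
    using t by (intro has_field_derivative_transform_within[OF g(2), of 1]) auto
qed

lemma continuous_on_series: "continuous_on ({-1..0} \<times> {0..T}) (\<lambda>(x, t). U n m x t)"
proof (rule uniform_limit_theorem[OF _ _ trivial_limit_sequentially])
  show "uniform_limit ({-1..0} \<times> {0..T})
      (\<lambda>N (x, t). \<Sum>k<N. coef y z (k + n) m t / fact k * x ^ k) (\<lambda>(x, t). U n m x t) sequentially"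
    unfolding series_def case_prod_unfold
    by (rule Weierstrass_m_test[OF _ summable_K[of n m]]) (use term_le in auto)
  have "continuous_on ({-1..0} \<times> {0..T}) (\<lambda>p. coef y z k m (snd p))" for k
    by (rule continuous_on_compose2[OF jets_continuous_on[OF jets_coef[OF jy jz]]])
       (auto intro: continuous_intros)
  then show "\<forall>\<^sub>F N in sequentially. continuous_on ({-1..0} \<times> {0..T})
      (\<lambda>(x, t). \<Sum>k<N. coef y z (k + n) m t / fact k * x ^ k)"
    unfolding case_prod_unfold by (intro always_eventually allI continuous_intros) auto
qed

lemma series_pde:
  assumes t: "t \<in> {0..T}" and x: "x \<in> {-1..0}"
  shows "U n (Suc m) x t + U (n + 1) m x t + U (n + 3) m x t - U (n + 5) m x t = 0"
proof -
  have x': "\<bar>x\<bar> \<le> 101/100" using x by auto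
  note s = summable_term[OF t x']
  have "U (n + 5) m x t = (\<Sum>k. coef y z (k + n) (Suc m) t / fact k * x ^ k
      + coef y z (k + (n + 1)) m t / fact k * x ^ k + coef y z (k + (n + 3)) m t / fact k * x ^ k)"
    unfolding series_def using coef_add_5[of y z "k + n" m t for k]
    by (simp add: add.assoc distrib_right add_divide_distrib)
  also have "\<dots> = U n (Suc m) x t + U (n + 1) m x t + U (n + 3) m x t"
    unfolding series_def by (simp only: suminf_add[symmetric] summable_add s)
  finally show ?thesis by simp
qed

lemma jets2_series: "jets2 U {-1..0} {0..T}"
  unfolding jets2_def using series_has_derivative_x series_has_derivative_t continuous_on_series by blast

text \<open>Here 22 = 11 * 2 and 110 = 11 * 2 * 5 collect the bases from \<open>K\<close>,
  \<open>fact_add_le\<close> and \<open>fact_times_5_le\<close>; 200 exceeds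
  \<open>(5/4)^4 * 12500/279\<close>, and \<open>M + 1\<close> keeps the constant positive.\<close>

lemma abs_series_le_gevrey:
  assumes t: "t \<in> {0..T}" and x: "x \<in> {-1..0}"
  shows "\<bar>U n m x t\<bar> \<le> (M + 1) * 200 * (fact n powr 1 / (1/22) ^ n) * (fact m powr 5 / (inverse (110 ^ 5)) ^ m)"
proof -
  have "fact m powr 5 = (fact m ^ 5 :: real)" using powr_realpow[of "fact m" 5] by simp
  note p = this
  have "\<bar>U n m x t\<bar> \<le> K n m * (12500/279)" by (rule abs_series_le[OF t x])
  also have "K n m \<le> (M * (5/4) ^ 4) * 11 ^ (n + 5 * m) * (2 ^ (n + 5 * m) * fact n * fact (5 * m))"
    unfolding K_def using M_nonneg by (intro mult_left_mono fact_add_le) auto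
  also have "\<dots> \<le> (M * (5/4) ^ 4) * 11 ^ (n + 5 * m) * (2 ^ (n + 5 * m) * fact n * (5 ^ (5 * m) * fact m ^ 5))"
    using M_nonneg by (intro mult_left_mono fact_times_5_le) auto
  also have "\<dots> * (12500/279) = (M * ((5/4) ^ 4 * (12500/279))) * ((22 ^ n * fact n) * (110 ^ (5 * m) * fact m ^ 5))"
  proof -
    have "(22::real) ^ n = 11 ^ n * 2 ^ n" by (simp flip: power_mult_distrib)
    moreover have "(110::real) ^ (5 * m) = 11 ^ (5 * m) * 2 ^ (5 * m) * 5 ^ (5 * m)"
      by (simp flip: power_mult_distrib)
    ultimately show ?thesis by (simp only: power_add ac_simps)
  qed
  also have "\<dots> \<le> ((M + 1) * 200) * ((22 ^ n * fact n) * (110 ^ (5 * m) * fact m ^ 5))"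
    using M_nonneg by (intro mult_right_mono mult_mono) (auto simp: eval_nat_numeral)
  also have "\<dots> = (M + 1) * 200 * (fact n powr 1 / (1/22) ^ n) * (fact m powr 5 / (inverse (110 ^ 5)) ^ m)"
  proof -
    have "fact n powr 1 / (1/22) ^ n = 22 ^ n * (fact n :: real)" by (simp add: power_one_over)
    moreover have inv: "F / inverse X ^ m = X ^ m * F" for F X :: real
      by (simp add: power_inverse divide_inverse)
    have "fact m powr 5 / (inverse (110 ^ 5)) ^ m = 110 ^ (5 * m) * (fact m ^ 5 :: real)"
      by (simp only: p inv power_mult)
    ultimately show ?thesis by (simp only: mult.assoc)
  qed
  finally show ?thesis by simp
qed

lemma series_at_0: "U n m 0 t = coef y z n m t"
proof -
  have "U n m 0 t = (\<Sum>k. coef y z (k + n) m t / fact k * 0 ^ k)" by (simp add: series_def)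
  also have "\<dots> = coef y z (0 + n) m t / fact 0" by (rule powser_zero)
  finally show ?thesis by simp
qed

lemma series_initial:
  assumes "\<And>m. y m 0 = 0" "\<And>m. z m 0 = 0"
  shows "U n m x 0 = 0"
proof -
  have "coef y z k m 0 = 0" for k m
    using assms by (induction y z k m rule: coef.induct) auto
  then show ?thesis by (simp add: series_def)
qed

lemma series_gevrey2: "U 0 0 \<in> gevrey2 1 5 (-1) 0 0 T"
  using M_nonneg T abs_series_le_gevrey
  by (intro gevrey2_jets2I[OF _ _ jets2_series, where C = "(M + 1) * 200" and ?R1.0 = "1/22" and ?R2.0 = "inverse (110 ^ 5)"]) auto

lemma series_trace_gevrey:
  assumes x: "x \<in> {-1..0}"
  shows "U n 0 x \<in> gevrey 5 0 T"
proof (rule gevrey_jetsI[where q = "\<lambda>m. U n m x" and C = "(M + 1) * 200 * (fact n powr 1 / (1/22) ^ n)" and B = "inverse (110 ^ 5)"])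
  show "jets (\<lambda>m. U n m x) {0..T}" using jets2_series x by (simp add: jets2_def jets_def)
  show "(M + 1) * 200 * (fact n powr 1 / (1/22) ^ n) > 0"
    using M_nonneg by (intro mult_pos_pos divide_pos_pos) auto
qed (use T abs_series_le_gevrey[OF _ x] in auto)

lemma series_solution:
  assumes "\<And>m. y m 0 = 0" "\<And>m. z m 0 = 0"
  shows "kawahara_solution T (U 0 0 (-1)) (U 1 0 (-1)) (U 0 0)"
proof -
  note j = jets2_series
  have I: "(-1::real) < 0" by simp
  have Dx: "(Dx_on (-1) 0 ^^ k) (U 0 0) x t = U k 0 x t" if "x \<in> {-1..0}" "t \<in> {0..T}" for k x t
    using Dx_on_funpow_jets2[OF I T j that(2) _ that(1), of "U 0 0" 0 0 k] by simp
  have Dx1: "Dx_on (-1) 0 (U 0 0) x t = U 1 0 x t" if "x \<in> {-1..0}" "t \<in> {0..T}" for x t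
    using Dx[OF that, of 1] by simp
  have Dt: "Dt_on 0 T (U 0 0) x t = U 0 1 x t" "U 0 0 x differentiable (at t within {0..T})"
    if "x \<in> {-1..0}" "t \<in> {0..T}" for x t
    using Dt_on_jets2[OF I T j that, of "U 0 0" 0 0] by simp_all
  have diff: "(\<lambda>y. (Dx_on (-1) 0 ^^ k) (U 0 0) y t) differentiable (at x within {-1..0})"
    if "x \<in> {-1..0}" "t \<in> {0..T}" for k x t
    using Dx_on_jets2(2)[OF I T j that, of "(Dx_on (-1) 0 ^^ k) (U 0 0)" k 0] Dx[OF _ that(2)] by simp
  have cont: "continuous_on ({-1..0} \<times> {0<..<T}) (\<lambda>(x, t). U n m x t)" for n m
    by (rule continuous_on_subset[OF continuous_on_series]) auto
  have cDx: "continuous_on ({-1..0} \<times> {0<..<T}) (\<lambda>(x, t). (Dx_on (-1) 0 ^^ k) (U 0 0) x t)" for k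
    using cont[of k 0] by (rule continuous_on_eq) (auto simp: Dx)
  have cDt: "continuous_on ({-1..0} \<times> {0<..<T}) (\<lambda>(x, t). Dt_on 0 T (U 0 0) x t)"
    using cont[of 0 1] by (rule continuous_on_eq) (auto simp: Dt)
  have pde: "Dt_on 0 T (U 0 0) x t + Dx_on (-1) 0 (U 0 0) x t
          + (Dx_on (-1) 0 ^^ 3) (U 0 0) x t - (Dx_on (-1) 0 ^^ 5) (U 0 0) x t = 0"
    if "x \<in> {-1..0}" "t \<in> {0..T}" for x t
    using series_pde[OF that(2,1), of 0 0] by (simp only: Dx1[OF that] Dx[OF that] Dt[OF that]) simp
  have bdry: "U 0 0 0 t = 0" "U 1 0 0 t = 0" "U 2 0 0 t = 0" for t
    by (simp_all add: series_at_0 numeral_2_eq_2)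
  show ?thesis
    unfolding kawahara_solution_def
  proof (intro conjI ballI allI impI)
    show "continuous_on ({-1..0} \<times> {0..T}) (\<lambda>(x, t). U 0 0 x t)" by (rule continuous_on_series)
  qed (use diff cDx cDt Dt(2) pde bdry Dx Dx1 series_initial[OF assms] T in auto)
qed

end

section \<open>Reachable states\<close>

text \<open>If \<open>p\<close> is the tower of \<open>u\<close>, the entry
  \<open>P_jets p m k\<close> is the \<open>k\<close>-th derivative of the \<open>m\<close>-th
  iterate of \<open>P\<close> on \<open>u\<close>; \<open>P\<close> has constant coefficients and
  commutes with differentiation.\<close>

primrec P_jets :: "(nat \<Rightarrow> real \<Rightarrow> real) \<Rightarrow> nat \<Rightarrow> nat \<Rightarrow> real \<Rightarrow> real" where
  "P_jets p 0 = p"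
| "P_jets p (Suc m) = (\<lambda>k x. P_jets p m (k + 1) x + P_jets p m (k + 3) x - P_jets p m (k + 5) x)"

lemma jets_P_jets: "jets p S \<Longrightarrow> jets (P_jets p m) S"
proof (induction m)
  case (Suc m)
  have "(P_jets p m (n + j) has_real_derivative P_jets p m (Suc n + j) x) (at x within S)"
    if "x \<in> S" for n j x
    using jetsD[OF Suc.IH[OF Suc.prems] that, of "n + j"] by simp
  then show ?case unfolding P_jets.simps by (intro jetsI DERIV_add DERIV_diff)
qed simp

lemma P_op_funpow:
  assumes p: "jets p {-1..0}" and f: "\<And>x. x \<in> {-1..0} \<Longrightarrow> f x = p 0 x" and "x \<in> {-1..0}"
  shows "(P_op ^^ m) f x = P_jets p m 0 x"
  using assms(3)
proof (induction m arbitrary: x)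
  case (Suc m)
  have D: "(D_on (-1) 0 ^^ k) ((P_op ^^ m) f) x = P_jets p m k x" for k
    by (rule D_on_funpow_jets[OF _ jets_P_jets[OF p] Suc.IH Suc.prems]) auto
  have "P_op g x = D_on (-1) 0 g x + (D_on (-1) 0 ^^ 3) g x - (D_on (-1) 0 ^^ 5) g x" for g
    by (simp add: P_op_def)
  with D[of 1] D[of 3] D[of 5] show ?case by simp
qed (use f in simp)

text \<open>Each application of \<open>P\<close> multiplies the bound by
  \<open>5^4/120 + 5^2/20 + 1\<close>, which is below 15/2.\<close>

lemma abs_P_jets_le:
  assumes "\<And>k. \<bar>p k 0\<bar> \<le> C * (fact k / 5 ^ k)"
  shows "\<bar>P_jets p m k 0\<bar> \<le> C * (15/2) ^ m * (fact (k + 5 * m) / 5 ^ (k + 5 * m))"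
proof (induction m arbitrary: k)
  case (Suc m)
  define w where "w N = fact N / (5::real) ^ N" for N
  define N where "N = k + 5 * m"
  have C: "C \<ge> 0" using assms[of 0] by simp
  note IH = Suc.IH[folded w_def]
  have "\<bar>P_jets p (Suc m) k 0\<bar> \<le> \<bar>P_jets p m (k + 1) 0\<bar> + \<bar>P_jets p m (k + 3) 0\<bar> + \<bar>P_jets p m (k + 5) 0\<bar>"
    unfolding P_jets.simps by linarith
  also have "\<dots> \<le> C * (15/2) ^ m * w (N + 1) + C * (15/2) ^ m * w (N + 3) + C * (15/2) ^ m * w (N + 5)"
    using IH[of "k + 1"] IH[of "k + 3"] IH[of "k + 5"]
    by (intro add_mono) (simp_all only: N_def ac_simps)
  also have "\<dots> \<le> C * (15/2) ^ m * (5 ^ 4 / 120 * w (N + 5)) + C * (15/2) ^ m * (5 ^ 2 / 20 * w (N + 5))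
      + C * (15/2) ^ m * w (N + 5)"
    unfolding w_def using C by (intro add_mono mult_left_mono fact_div_power_le) auto
  also have "\<dots> = C * (15/2) ^ m * w (N + 5) * (5 ^ 4 / 120 + 5 ^ 2 / 20 + 1)"
    by (simp only: distrib_left mult_1_right ac_simps)
  also have "\<dots> \<le> C * (15/2) ^ m * w (N + 5) * (15/2)"
    using C by (intro mult_left_mono) (auto simp: w_def)
  also have "\<dots> = C * (15/2) ^ Suc m * w (k + 5 * Suc m)"
    by (simp add: N_def ac_simps)
  finally show ?case by (simp only: w_def)
qed (use assms in simp)

text \<open>The polynomial factor is absorbed because \<open>(15/2) / 5\<^sup>5 < 1 / 3\<^sup>5\<close>.\<close>

lemma fact_add_4_le:
  assumes "k \<le> 4"
  shows "(15/2) ^ m * (fact (k + 5 * m) / 5 ^ (k + 5 * m)) \<le> 2000000 * (fact (5 * m) / (3::real) ^ (5 * m))"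
proof -
  let ?N = "5 * m"
  define x :: real where "x = ?N + 4"
  have "fact (k + ?N) \<le> (fact (?N + 4) :: real)" using assms by (intro fact_mono) auto
  also have "\<dots> = real (?N + 4) * (real (?N + 3) * (real (?N + 2) * (real (?N + 1) * fact ?N)))"
    by (simp add: numeral_eq_Suc)
  also have "\<dots> \<le> x * (x * (x * (x * fact ?N)))"
    unfolding x_def by (intro mult_mono) auto
  also have "\<dots> = x ^ 4 * fact ?N" by (simp add: eval_nat_numeral)
  finally have f: "fact (k + ?N) \<le> x ^ 4 * fact ?N" .
  \<comment> \<open>Geometric decay in \<open>m\<close> is rewritten as exponential decay in
    \<open>x = 5 m + 4\<close>, so that \<open>power_exp_le\<close> with exponent 4 absorbs
    \<open>x ^ 4\<close>.\<close>
  have "(6/10::real) ^ m \<le> exp (- (4/10)) ^ m"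
    using exp_ge_add_one_self[of "- (4/10)"] by (intro power_mono) auto
  also have "\<dots> = exp (- (8/100 * x) + 32/100)"
    by (simp add: x_def field_simps flip: exp_of_nat_mult)
  also have "\<dots> = exp (- (8/100 * x)) * exp (32/100)" by (rule exp_add)
  also have "\<dots> \<le> exp (- (8/100 * x)) * exp 1" by (intro mult_left_mono) auto
  also have "\<dots> \<le> exp (- (8/100 * x)) * 3" by (intro mult_left_mono exp_le) auto
  finally have "x ^ 4 * (6/10::real) ^ m \<le> x ^ 4 * (exp (- (8/100 * x)) * 3)"
    by (intro mult_left_mono) (auto simp: x_def)
  also have "\<dots> = (x ^ 4 * exp (- (8/100 * x))) * 3" by simp
  also have "\<dots> \<le> (fact 4 / (8/100) ^ 4) * 3"
    by (intro mult_right_mono power_exp_le) (auto simp: x_def)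
  also have "\<dots> \<le> 2000000" by (simp add: fact_numeral eval_nat_numeral)
  finally have x4: "x ^ 4 * (6/10::real) ^ m \<le> 2000000" .
  have "(15/2) ^ m * (fact (k + ?N) / 5 ^ (k + ?N)) \<le> (15/2) ^ m * (x ^ 4 * fact ?N / 5 ^ ?N)"
    using f by (intro mult_left_mono frac_le) (auto simp: x_def intro: power_increasing)
  also have "\<dots> = x ^ 4 * ((15/2) / 5 ^ 5) ^ m * fact ?N"
    by (simp only: power_mult power_divide) simp
  \<comment> \<open>Numerically 0.0024 against about 0.00247; the margin 6/10 is what absorbs the
    polynomial.\<close>
  also have "\<dots> \<le> x ^ 4 * ((6/10) / 3 ^ 5) ^ m * fact ?N"
    by (intro mult_right_mono mult_left_mono power_mono) (auto simp: x_def)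
  also have "\<dots> = x ^ 4 * (6/10) ^ m * (fact ?N / 3 ^ ?N)"
    by (simp only: power_mult power_divide) simp
  also have "\<dots> \<le> 2000000 * (fact ?N / 3 ^ ?N)"
    by (intro mult_right_mono x4) simp
  finally show ?thesis .
qed

text \<open>Since \<open>(7/5)^5 < 6\<close> and the exponential is at least 1,
  \<open>2 * R0\<close> is at least 28/5, which leaves room for the closed disc of radius 5.\<close>

lemma R0_bound: "2 * R0 > 5"
proof -
  have "(7/5::real) = ((7/5) ^ 5) powr (1/5)"
    by (subst powr_realpow[symmetric], simp, subst powr_powr) simp
  also have "\<dots> \<le> 6 powr (1/5)" by (intro powr_mono2) (auto simp: eval_nat_numeral)
  finally have "7/5 * 1 \<le> 6 powr (1/5) * exp (inverse (5 * exp 1 :: real))"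
    by (intro mult_mono) auto
  then show ?thesis by (simp add: R0_def)
qed

lemma reachable_state_expansion:
  assumes "R > 5" "u1 \<in> reachable_states R"
  obtains p C where "jets p {-1..0}" "\<And>x. x \<in> {-1..0} \<Longrightarrow> u1 x = p 0 x"
    "\<And>k. \<bar>p k 0\<bar> \<le> C * (fact k / 5 ^ k)" "\<And>x. x \<in> {-1..0} \<Longrightarrow> (\<lambda>k. p k 0 / fact k * x ^ k) sums u1 x"
proof -
  obtain z where hol: "z holomorphic_on ball 0 R"
    and z: "\<And>x. x \<in> {-1..0} \<Longrightarrow> z (complex_of_real x) = complex_of_real (u1 x)"
    using assms(2) by (auto simp: reachable_states_def)
  define p where "p k x = Re ((deriv ^^ k) z (of_real x))" for k x
  have ball: "of_real x \<in> ball (0::complex) R" if "x \<in> {-1..0}" for x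
    using that assms(1) by auto
  have cont: "continuous_on (cball 0 5) z"
    by (rule holomorphic_on_imp_continuous_on, rule holomorphic_on_subset[OF hol]) (use assms(1) in auto)
  then have "compact (z ` cball 0 5)" by (rule compact_continuous_image) auto
  then obtain C where C: "\<And>w. w \<in> cball 0 5 \<Longrightarrow> norm (z w) \<le> C"
    by (meson bounded_iff compact_imp_bounded imageI)
  show thesis
  proof (rule that[of p C])
    show "jets p {-1..0}"
    proof (rule jetsI)
      fix k x assume x: "x \<in> {-1..0::real}"
      have h: "(deriv ^^ k) z holomorphic_on ball 0 R"
        by (intro holomorphic_higher_deriv hol) auto
      have "((deriv ^^ k) z has_field_derivative (deriv ^^ Suc k) z (of_real x)) (at (of_real x))"
        using holomorphic_derivI[OF h open_ball ball[OF x], of UNIV] by simp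
      then have "((\<lambda>x. (deriv ^^ k) z (of_real x)) has_vector_derivative (deriv ^^ Suc k) z (of_real x)) (at x)"
        by (rule has_vector_derivative_real_field)
      then have "(p k has_real_derivative p (Suc k) x) (at x)"
        unfolding p_def has_real_derivative_iff_has_vector_derivative
        by (rule bounded_linear.has_vector_derivative[OF bounded_linear_Re])
      then show "(p k has_real_derivative p (Suc k) x) (at x within {-1..0})"
        by (rule has_field_derivative_at_within)
    qed
    show "u1 x = p 0 x" if "x \<in> {-1..0}" for x using z[OF that] by (simp add: p_def)
    show "\<bar>p k 0\<bar> \<le> C * (fact k / 5 ^ k)" for k
    proof -
      have "norm ((deriv ^^ k) z 0) \<le> fact k * C / 5 ^ k"
        by (rule Cauchy_inequality[OF holomorphic_on_subset[OF hol] cont])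
           (use assms(1) C in auto)
      then have "\<bar>Re ((deriv ^^ k) z 0)\<bar> \<le> fact k * C / 5 ^ k"
        by (rule order_trans[OF abs_Re_le_cmod])
      then show ?thesis by (simp add: p_def mult.commute)
    qed
    fix x assume x: "x \<in> {-1..0::real}"
    have "(\<lambda>k. (deriv ^^ k) z 0 / fact k * (of_real x - 0) ^ k) sums z (of_real x)"
      by (rule holomorphic_power_series[OF hol ball[OF x]])
    then have "(\<lambda>k. Re ((deriv ^^ k) z 0 / fact k * (of_real x - 0) ^ k)) sums Re (z (of_real x))"
      by (rule sums_Re)
    moreover have "Re (c / fact k * (of_real x - 0) ^ k) = Re c / fact k * x ^ k" for c k
    proof -
      have "c / fact k * (of_real x - 0) ^ k = of_real (x ^ k / fact k) * c" by simp
      then have "Re (c / fact k * (of_real x - 0) ^ k) = Re (of_real (x ^ k / fact k) * c)" by (rule arg_cong)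
      also have "\<dots> = x ^ k / fact k * Re c"
        by (simp only: times_complex.sel Re_complex_of_real Im_complex_of_real mult_zero_left diff_zero)
      finally show ?thesis by simp
    qed
    ultimately show "(\<lambda>k. p k 0 / fact k * x ^ k) sums u1 x"
      using z[OF x] by (simp add: p_def)
  qed
qed

section \<open>Matching the flat outputs to the target state\<close>

theorem theorem1p2:
  fixes T R :: real and u1 :: "real \<Rightarrow> real"
  assumes "T > 0" and "R > 2 * R0" and "u1 \<in> reachable_states R"
  shows "\<exists>h1\<in>gevrey 5 0 T. \<exists>h2\<in>gevrey 5 0 T. \<exists>u.
           kawahara_solution T h1 h2 u \<and>
           (\<forall>v. kawahara_solution T h1 h2 v \<longrightarrow> (\<forall>x\<in>{-1..0}. \<forall>t\<in>{0..T}. v x t = u x t)) \<and>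
           (\<forall>x\<in>{-1..0}. u x T = u1 x) \<and>
           u \<in> gevrey2 1 5 (-1) 0 0 T"
proof -
  have R: "R > 5" using assms(2) R0_bound by simp
  obtain p C where p: "jets p {-1..0}" and u1: "\<And>x. x \<in> {-1..0} \<Longrightarrow> u1 x = p 0 x"
    and p_le: "\<And>k. \<bar>p k 0\<bar> \<le> C * (fact k / 5 ^ k)"
    and sums: "\<And>x. x \<in> {-1..0} \<Longrightarrow> (\<lambda>k. p k 0 / fact k * x ^ k) sums u1 x"
    by (rule reachable_state_expansion[OF R assms(3)]) (rule that)
  \<comment> \<open>Along a solution a time derivative acts as \<open>- P\<close>, so these are the
    values that the \<open>m\<close>-th time derivative of \<open>a_k\<close> must take at
    \<open>T\<close>.\<close>
  define d where "d k m = (- 1) ^ m * P_jets p m k 0" for k m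
  have C: "C \<ge> 0" using p_le[of 0] by simp
  \<comment> \<open>The compatibility conditions of \<open>reachable_states\<close> are what
    \<open>a_0 = a_1 = a_2 = 0\<close> demands at time \<open>T\<close>.\<close>
  have d_0: "d k m = 0" if "k < 3" for k m
  proof -
    have "(D_on (-1) 0 ^^ k) ((P_op ^^ m) u1) 0 = P_jets p m k 0"
      by (rule D_on_funpow_jets[OF _ jets_P_jets[OF p] P_op_funpow[OF p u1]]) auto
    moreover have "(D_on (-1) 0 ^^ k) ((P_op ^^ m) u1) 0 = 0"
    proof -
      have "k \<in> {0, 1, 2}" using that by auto
      then show ?thesis using assms(3) unfolding reachable_states_def by blast
    qed
    ultimately show ?thesis by (simp add: d_def)
  qed
  have d_le: "\<bar>d k m\<bar> \<le> (C * 2000000) * fact (5 * m) / 3 ^ (5 * m)" if "k \<le> 4" for k m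
  proof -
    have "\<bar>d k m\<bar> = \<bar>P_jets p m k 0\<bar>" by (simp add: d_def abs_mult)
    also have "\<dots> \<le> C * ((15/2) ^ m * (fact (k + 5 * m) / 5 ^ (k + 5 * m)))"
      using abs_P_jets_le[of p C, OF p_le] by (simp add: mult.assoc)
    also have "\<dots> \<le> C * (2000000 * (fact (5 * m) / 3 ^ (5 * m)))"
      by (intro mult_left_mono fact_add_4_le that C)
    finally show ?thesis by simp
  qed
  obtain y M where y: "jets y {0..T}" "\<And>m. y m T = d 3 m" "\<And>m. y m 0 = 0"
    and y_le: "\<And>m t. t \<in> {0..T} \<Longrightarrow> \<bar>y m t\<bar> \<le> M * (fact (5 * m) / (5/4) ^ (5 * m))"
    by (rule borel_interval[OF assms(1) d_le[of 3]]) (simp, rule that)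
  obtain z N where z: "jets z {0..T}" "\<And>m. z m T = d 4 m" "\<And>m. z m 0 = 0"
    and z_le: "\<And>m t. t \<in> {0..T} \<Longrightarrow> \<bar>z m t\<bar> \<le> N * (fact (5 * m) / (5/4) ^ (5 * m))"
    by (rule borel_interval[OF assms(1) d_le[of 4]]) (simp, rule that)
  interpret kawahara_series y z T "max M N"
  proof
    fix m t assume t: "t \<in> {0..T}"
    show "\<bar>y m t\<bar> \<le> max M N * (fact (5 * m) / (5/4) ^ (5 * m))"
      by (rule order_trans[OF y_le[OF t]], rule mult_right_mono) auto
    show "\<bar>z m t\<bar> \<le> max M N * (fact (5 * m) / (5/4) ^ (5 * m))"
      by (rule order_trans[OF z_le[OF t]], rule mult_right_mono) auto
  qed (use assms(1) y z in auto)
  \<comment> \<open>Solving the definition of \<open>P\<close> for its fifth-order term shows that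
    \<open>d\<close> obeys the recursion of \<open>coef\<close>; the starting rows agree by
    \<open>d_0\<close> and by the choice of \<open>y\<close> and \<open>z\<close>.\<close>
  have coef_T: "coef y z k m T = d k m" for k m
    using y(2) z(2)
  proof (induction y z k m rule: coef.induct)
    case (6 y z k m)
    have "d (Suc (Suc (Suc (Suc (Suc k))))) m = d k (Suc m) + d (Suc k) m + d (Suc (Suc (Suc k))) m"
      by (simp add: d_def numeral_eq_Suc algebra_simps)
    then show ?case using 6 by simp
  qed (simp_all add: d_0 numeral_eq_Suc)
  \<comment> \<open>At time \<open>T\<close> the series in \<open>x\<close> is the Taylor series of
    \<open>u1\<close> at 0, which converges to \<open>u1\<close> on the whole interval.\<close>
  have final: "U 0 0 x T = u1 x" if "x \<in> {-1..0}" for x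
    using sums_unique[OF sums[OF that]] by (simp add: series_def coef_T d_def)
  have sol: "kawahara_solution T (U 0 0 (-1)) (U 1 0 (-1)) (U 0 0)"
    by (rule series_solution) (simp_all add: y z)
  show ?thesis
  proof (intro bexI exI conjI allI impI ballI)
    fix v and x t :: real assume "kawahara_solution T (U 0 0 (-1)) (U 1 0 (-1)) v" "x \<in> {-1..0}" "t \<in> {0..T}"
    then show "v x t = U 0 0 x t" using kawahara_solution_unique[OF assms(1) sol] by simp
  qed (use sol final series_gevrey2 series_trace_gevrey in auto)
qed

end
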